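(* Let $\varphi$ be an Orlicz function, let $I=(0,a)$ with $0<a\le\infty$, and let $w$ be a decreasing weight function on $I$. (i) For every $f\in L^0$, $$\int_I \varphi\left(\frac{f^*}{w}\right) w = \inf\left\{\int_I \varphi\left(\frac{|f|}{v}\right) v : v\sim w,\ v\ge 0\right\}.$$ (ii) If $I=(0,a)$ with $a<\infty$, then for every $f\in L^0$ also $$\int_I \varphi\left(\frac{f^*}{w}\right) w = \inf\left\{\int_I \varphi\left(\frac{|f|}{v}\right) v : v\sim w,\ v>0\right\} = \inf\left\{\int_I \varphi\left(\frac{|f|}{w\circ\sigma}\right) w\circ\sigma : \sigma \text{ a measure preserving mapping from } I \text{ onto } I\right\}.$$
   Context: An Orlicz function is a convex, strictly increasing function $\varphi:\mathbb{R}_+\to\mathbb{R}_+$ with $\varphi(0)=0$. "Decreasing" means non-increasing. $L^0$ is the set of all Lebesgue measurable functions $f:I\to\mathbb{R}$; $|A|$ is the Lebesgue measure of $A$. For $f\in L^0$, $d_f(s)=|\{t\in I:|f(t)|>s\}|$ for $s\ge 0$ and $f^*(t)=\inf\{s\ge 0: d_f(s)\le t\}$, $t\in I$ ($\inf\emptyset=\infty$). $f\sim g$ means $f^*=g^*$. A weight function is a non-negative decreasing $w\in L^0$ (it need not be integrable near $0$). A map $\tau:I\to I$ is measure preserving if for every measurable $A\subset I$, $\tau^{-1}(A)$ is measurable with $|\tau^{-1}(A)|=|A|$. Convention: if $v(t)=0$ then $\varphi(|f(t)|/v(t))\,v(t)$ is defined as $0$ if $f(t)=0$ and $\infty$ if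 $f(t)\neq 0$ (likewise for $f^*,w$); the expression is $\infty$ where $f^*(t)=\infty$. Integrals take values in $[0,\infty]$; $v$ ranges over measurable functions on $I$.
   Formalization: In (ii) the equality with the infimum over v > 0 is stated only when w > 0 on I or the left-hand integral is infinite; otherwise no v > 0 with v ∼ w exists, the infimum is ∞ and the equality fails (e.g. w = 0, f = 0). *)

theory Defs
  imports "HOL-Analysis.Analysis"
begin

text \<open>Functions on an interval \<open>I\<close> are modelled by total functions on the reals, of which only
  the values on \<open>I\<close> are ever used. Similarly, an Orlicz function is only used on
  \<open>{0..}\<close>.\<close>

definition orlicz_function :: "(real \<Rightarrow> real) \<Rightarrow> bool" where
  "orlicz_function \<phi> \<longleftrightarrow>
     \<phi> \<in> {0..} \<rightarrow> {0..} \<and> convex_on {0..} \<phi> \<and> strict_mono_on {0..} \<phi> \<and> \<phi> 0 = 0"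

definition L0 :: "real set \<Rightarrow> (real \<Rightarrow> real) set" where
  "L0 I = borel_measurable (lebesgue_on I)"

definition distribution_fun :: "real set \<Rightarrow> (real \<Rightarrow> real) \<Rightarrow> real \<Rightarrow> ennreal" where
  "distribution_fun I f s = emeasure lebesgue {t \<in> I. s < \<bar>f t\<bar>}"

text \<open>The decreasing rearrangement \<open>f\<^sup>*\<close>. It is extended real valued, since
  the infimum of the empty set is \<open>\<infinity>\<close>; this can occur only if \<open>I\<close> has infinite measure.\<close>

definition rearrangement :: "real set \<Rightarrow> (real \<Rightarrow> real) \<Rightarrow> real \<Rightarrow> ennreal" where
  "rearrangement I f t = (INF s \<in> {s. 0 \<le> s \<and> distribution_fun I f s \<le> ennreal t}. ennreal s)"

definition equimeasurable :: "real set \<Rightarrow> (real \<Rightarrow> real) \<Rightarrow> (real \<Rightarrow> real) \<Rightarrow> bool" where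
  "equimeasurable I f g \<longleftrightarrow> (\<forall>t\<in>I. rearrangement I f t = rearrangement I g t)"

definition weight_function :: "real set \<Rightarrow> (real \<Rightarrow> real) \<Rightarrow> bool" where
  "weight_function I w \<longleftrightarrow> w \<in> L0 I \<and> (\<forall>t\<in>I. 0 \<le> w t) \<and> antimono_on I w"

definition measure_preserving_on :: "real set \<Rightarrow> (real \<Rightarrow> real) \<Rightarrow> bool" where
  "measure_preserving_on I \<tau> \<longleftrightarrow> \<tau> \<in> I \<rightarrow> I \<and>
     (\<forall>A. A \<subseteq> I \<and> A \<in> sets lebesgue \<longrightarrow>
        \<tau> -` A \<inter> I \<in> sets lebesgue \<and> emeasure lebesgue (\<tau> -` A \<inter> I) = emeasure lebesgue A)"

text \<open>The value of \<open>\<phi> (x / y) * y\<close> for \<open>x \<in> [0, \<infinity>]\<close> and real \<open>y \<ge> 0\<close>, with the convention that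
  for \<open>y = 0\<close> it is \<open>0\<close> if \<open>x = 0\<close> and \<open>\<infinity>\<close> otherwise, and that it is \<open>\<infinity>\<close> for \<open>x = \<infinity>\<close>.\<close>

definition orlicz_term :: "(real \<Rightarrow> real) \<Rightarrow> ennreal \<Rightarrow> real \<Rightarrow> ennreal" where
  "orlicz_term \<phi> x y =
     (if x = \<infinity> then \<infinity>
      else if y = 0 then (if x = 0 then 0 else \<infinity>)
      else ennreal (\<phi> (enn2real x / y) * y))"

definition orlicz_integral ::
    "(real \<Rightarrow> real) \<Rightarrow> real set \<Rightarrow> (real \<Rightarrow> ennreal) \<Rightarrow> (real \<Rightarrow> real) \<Rightarrow> ennreal" where
  "orlicz_integral \<phi> I g v = (\<integral>\<^sup>+ t. orlicz_term \<phi> (g t) (v t) \<partial>lebesgue_on I)"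

text \<open>A remark on the infimum over \<open>v > 0\<close> in the case of finite \<open>a\<close>. If the decreasing weight \<open>w\<close>
  vanishes somewhere on \<open>I = (0, a)\<close>, then it vanishes on a set of positive measure, and there is
  no \<open>v > 0\<close> equimeasurable with it. The infimum is then \<open>\<infinity>\<close>, so that the equality holds only if
  the integral of \<open>\<phi> (f\<^sup>* / w) w\<close> is \<open>\<infinity>\<close> as well; it fails for \<open>f = 0\<close>. This equality is therefore
  stated under the condition that \<open>w > 0\<close> on \<open>I\<close> or that integral is \<open>\<infinity>\<close>, which excludes
  exactly the cases in which it is false.\<close>

end

theory Submission
  imports Defs
begin

text \<open>Lower bound: since \<open>\<phi>\<close> is convex with \<open>\<phi> 0 = 0\<close>, the integrand \<open>\<phi> (x / y) * y\<close> is a limit of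
  superpositions of the functions \<open>(x - s * y)\<^sub>+\<close>. By Tonelli, the integral of \<open>(\<bar>f\<bar> - s * v)\<^sub>+\<close> is the
  integral over \<open>u\<close> of the measure of \<open>{s * v \<le> u < \<bar>f\<bar>}\<close>, which is at least the difference of the
  distribution functions of \<open>\<bar>f\<bar>\<close> and \<open>s * v\<close> at \<open>u\<close>; for \<open>f\<^sup>*\<close> and the decreasing \<open>w\<close> the level sets
  are nested, so that equality holds there.

  Attainment: if the integral of \<open>\<phi> (f\<^sup>* / w) w\<close> is finite or \<open>I\<close> is bounded, then \<open>\<bar>f\<bar>\<close> has finite
  distribution function on \<open>{0<..}\<close>, and \<open>\<bar>f\<bar> = f\<^sup>* \<circ> \<rho>\<close> for a measure preserving \<open>\<rho>\<close> defined on a set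
  outside of which \<open>f\<close> vanishes almost everywhere. The infimum is attained at \<open>w \<circ> \<rho>\<close>, extended by
  \<open>0\<close>.\<close>

section \<open>Distribution functions and truncated differences\<close>

text \<open>The convention at the zeros of a weight is the obstacle in the lower bound: truncated
  differences do not see it, so the points where \<open>w\<close> vanishes need a separate argument
  on supports. The measure \<open>d\<phi>'\<close> is never formed, as \<open>\<phi>\<close> need
  not be differentiable; second differences on a mesh replace it, and the mesh width tends to 0
  under Fatou's lemma.

  In the attainment, \<open>\<rho>\<close> is the rank of a point when \<open>I\<close> is ordered
  by decreasing \<open>\<bar>f\<bar>\<close>. For infinite \<open>a\<close> its domain can miss a
  set of infinite measure: if \<open>f\<close> is nonzero on a set of infinite measure, then its
  zeros have infinite rank. There both \<open>f\<close> and the extended weight are 0, which costs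
  nothing by the convention. For finite \<open>a\<close> the rank lies in \<open>I\<close> almost
  everywhere, so a map of \<open>I\<close> into itself results; it becomes onto by a change on a
  null set. If the left-hand side is infinite, the lower bound alone gives equality.\<close>

lemma L0_sets_greater [measurable]:
  assumes "I \<in> sets lebesgue" "f \<in> L0 I"
  shows "{t \<in> I. s < \<bar>f t\<bar>} \<in> sets lebesgue"
proof -
  have [measurable]: "f \<in> borel_measurable (lebesgue_on I)"
    using assms(2) by (simp add: L0_def)
  have "{t \<in> space (lebesgue_on I). s < \<bar>f t\<bar>} \<in> sets (lebesgue_on I)"
    by measurable
  then show ?thesis
    using assms(1) by (simp add: sets_restrict_space_iff)
qed

lemma distribution_fun_antimono:
  assumes "I \<in> sets lebesgue" "f \<in> L0 I" "s \<le> u"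
  shows "distribution_fun I f u \<le> distribution_fun I f s"
  unfolding distribution_fun_def
  using assms by (intro emeasure_mono) (auto intro: L0_sets_greater)

lemma distribution_fun_le_emeasure:
  assumes "I \<in> sets lebesgue"
  shows "distribution_fun I f s \<le> emeasure lebesgue I"
  unfolding distribution_fun_def using assms by (intro emeasure_mono) auto

text \<open>Right continuity of the distribution function: the superlevel sets at
  \<open>s + 1 / real (Suc n)\<close> increase to the one at \<open>s\<close>.\<close>

lemma distribution_fun_greaterE:
  assumes I: "I \<in> sets lebesgue" "f \<in> L0 I" and c: "c < distribution_fun I f s"
  obtains u where "s < u" "c < distribution_fun I f u"
proof -
  have "(SUP n. emeasure lebesgue {t \<in> I. s + 1 / real (Suc n) < \<bar>f t\<bar>}) =
      emeasure lebesgue (\<Union>n. {t \<in> I. s + 1 / real (Suc n) < \<bar>f t\<bar>})"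
  proof (rule SUP_emeasure_incseq)
    show "range (\<lambda>n. {t \<in> I. s + 1 / real (Suc n) < \<bar>f t\<bar>}) \<subseteq> sets lebesgue"
      using I by (auto intro: L0_sets_greater)
    have "1 / real (Suc n) \<le> 1 / real (Suc m)" if "m \<le> n" for m n
      using that by (simp add: frac_le)
    then show "incseq (\<lambda>n. {t \<in> I. s + 1 / real (Suc n) < \<bar>f t\<bar>})"
      by (fastforce simp: incseq_def)
  qed
  also have "(\<Union>n. {t \<in> I. s + 1 / real (Suc n) < \<bar>f t\<bar>}) = {t \<in> I. s < \<bar>f t\<bar>}"
  proof (intro equalityI subsetI)
    fix t assume "t \<in> {t \<in> I. s < \<bar>f t\<bar>}"
    then have "0 < \<bar>f t\<bar> - s" "t \<in> I" by auto
    then obtain n where "1 / real (Suc n) < \<bar>f t\<bar> - s"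
      using nat_approx_posE by blast
    with \<open>t \<in> I\<close> show "t \<in> (\<Union>n. {t \<in> I. s + 1 / real (Suc n) < \<bar>f t\<bar>})"
      by (auto simp: algebra_simps)
  next
    fix t assume "t \<in> (\<Union>n. {t \<in> I. s + 1 / real (Suc n) < \<bar>f t\<bar>})"
    then obtain n where "t \<in> I" "s + 1 / real (Suc n) < \<bar>f t\<bar>" by blast
    moreover have "0 < 1 / real (Suc n)" by simp
    ultimately show "t \<in> {t \<in> I. s < \<bar>f t\<bar>}"
      unfolding mem_Collect_eq by linarith
  qed
  finally have "c < (SUP n. emeasure lebesgue {t \<in> I. s + 1 / real (Suc n) < \<bar>f t\<bar>})"
    using c by (simp add: distribution_fun_def)
  then obtain n where "c < distribution_fun I f (s + 1 / real (Suc n))"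
    unfolding less_SUP_iff distribution_fun_def by blast
  then show ?thesis
    using that[of "s + 1 / real (Suc n)"] by simp
qed

text \<open>The duality by which \<open>f\<^sup>*\<close> is handled through the distribution
  function. Right continuity is what makes it hold with strict inequalities on both sides.\<close>

lemma less_rearrangement_iff:
  assumes I: "I \<in> sets lebesgue" "f \<in> L0 I" and "0 \<le> s"
  shows "ennreal s < rearrangement I f t \<longleftrightarrow> ennreal t < distribution_fun I f s"
proof
  assume "ennreal s < rearrangement I f t"
  then show "ennreal t < distribution_fun I f s"
    unfolding rearrangement_def using \<open>0 \<le> s\<close>
    by (metis (mono_tags, lifting) INF_lower leD leI mem_Collect_eq)
next
  assume "ennreal t < distribution_fun I f s"
  then obtain u where u: "s < u" "ennreal t < distribution_fun I f u"
    using distribution_fun_greaterE[OF I] by blast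
  have "ennreal u \<le> rearrangement I f t"
    unfolding rearrangement_def
  proof (rule INF_greatest)
    fix s' assume s': "s' \<in> {s. 0 \<le> s \<and> distribution_fun I f s \<le> ennreal t}"
    have "u \<le> s'"
    proof (rule ccontr)
      assume "\<not> u \<le> s'"
      then have "distribution_fun I f u \<le> distribution_fun I f s'"
        using distribution_fun_antimono[OF I] by simp
      with s' u show False by auto
    qed
    then show "ennreal u \<le> ennreal s'" by (rule ennreal_leI)
  qed
  moreover have "ennreal s < ennreal u"
    using u \<open>0 \<le> s\<close> by (simp add: ennreal_lessI)
  ultimately show "ennreal s < rearrangement I f t" by simp
qed

lemma ennreal_eq_infinityI:
  assumes "\<And>r. 0 \<le> r \<Longrightarrow> ennreal r \<le> x"
  shows "x = \<infinity>"
proof (cases x)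
  case (real r)
  then show ?thesis using assms[of "r + 1"] by simp
qed simp

lemma emeasure_lebesgue_atLeast: "emeasure lebesgue {y :: real..} = \<infinity>"
proof (rule ennreal_eq_infinityI)
  fix r :: real assume "0 \<le> r"
  then have "ennreal r = emeasure lebesgue {y..<y + r}" by simp
  also have "\<dots> \<le> emeasure lebesgue {y..}" by (rule emeasure_mono) auto
  finally show "ennreal r \<le> emeasure lebesgue {y..}" .
qed

lemma emeasure_einterval_0:
  assumes "0 \<le> a"
  shows "emeasure lebesgue (einterval 0 a) = e2ennreal a"
proof (cases a)
  case (real r)
  then have "einterval 0 a = {0<..<r}" by (auto simp: einterval_iff)
  with real assms show ?thesis by (simp add: e2ennreal_ereal)
next
  case PInf
  have "ennreal r \<le> emeasure lebesgue (einterval 0 a)" if "0 \<le> r" for r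
  proof -
    have "ennreal r = emeasure lebesgue {0<..<r}" using that by simp
    also have "\<dots> \<le> emeasure lebesgue (einterval 0 a)"
      using PInf by (intro emeasure_mono) (auto simp: einterval_iff)
    finally show ?thesis .
  qed
  then have "emeasure lebesgue (einterval 0 a) = \<infinity>"
    by (rule ennreal_eq_infinityI)
  then show ?thesis using PInf by simp
qed (use assms in auto)

text \<open>Rearrangements are compared only on \<open>I\<close>. This suffices: a number strictly
  between two distinct values of the distribution functions is positive and below the measure of
  \<open>I\<close>, hence a point of \<open>I\<close> at which the rearrangements differ.\<close>

lemma equimeasurable_einterval_iff:
  fixes a :: ereal
  defines "I \<equiv> einterval 0 a"
  assumes a: "0 < a" and f: "f \<in> L0 I" and g: "g \<in> L0 I"
  shows "equimeasurable I f g \<longleftrightarrow> (\<forall>s\<ge>0. distribution_fun I f s = distribution_fun I g s)"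
proof
  assume "\<forall>s\<ge>0. distribution_fun I f s = distribution_fun I g s"
  then have "{s. 0 \<le> s \<and> distribution_fun I f s \<le> ennreal t} =
      {s. 0 \<le> s \<and> distribution_fun I g s \<le> ennreal t}" for t
    by auto
  then show "equimeasurable I f g"
    unfolding equimeasurable_def rearrangement_def by simp
next
  have I: "I \<in> sets lebesgue" by (simp add: I_def)
  have le: "distribution_fun I g s \<le> distribution_fun I f s"
    if fg: "equimeasurable I f g" "0 \<le> s" and f: "f \<in> L0 I" and g: "g \<in> L0 I" for s f g
  proof (rule ccontr)
    assume "\<not> ?thesis"
    then obtain t where t: "0 < t" "distribution_fun I f s < ennreal t" "ennreal t < distribution_fun I g s"
      using ennreal_rat_dense not_le
      by (smt (verit, best) ennreal_neg not_less_zero)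
    have "ennreal t < e2ennreal a"
      using t distribution_fun_le_emeasure[OF I, of g s] emeasure_einterval_0[of a] a
      by (simp add: I_def)
    then have "ereal t < a"
      using \<open>0 < t\<close> a by (cases a) (auto simp: e2ennreal_ereal ennreal_less_iff)
    then have "t \<in> I" using \<open>0 < t\<close> by (simp add: I_def einterval_iff)
    then have "rearrangement I f t = rearrangement I g t"
      using fg by (simp add: equimeasurable_def)
    then show False
      using t less_rearrangement_iff[OF I f \<open>0 \<le> s\<close>, of t] less_rearrangement_iff[OF I g \<open>0 \<le> s\<close>, of t]
      by auto
  qed
  assume "equimeasurable I f g"
  moreover then have "equimeasurable I g f" by (simp add: equimeasurable_def)
  ultimately show "\<forall>s\<ge>0. distribution_fun I f s = distribution_fun I g s"
    using le f g by (simp add: antisym)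
qed

lemma borel_measurable_rearrangement [measurable]:
  assumes I: "I \<in> sets lebesgue" "f \<in> L0 I"
  shows "rearrangement I f \<in> borel_measurable (lebesgue_on J)"
proof (rule measurable_restrict_space1, rule borel_measurableI_greater)
  fix y :: ennreal
  show "{t \<in> space lebesgue. y < rearrangement I f t} \<in> sets lebesgue"
  proof (cases y)
    case (real s)
    then have "{t \<in> space lebesgue. y < rearrangement I f t} = {t. ennreal t < distribution_fun I f s}"
      using less_rearrangement_iff[OF I] by simp
    also have "\<dots> \<in> sets borel" by measurable
    finally show ?thesis by (metis sets_completionI_sets sets_lborel)
  qed simp
qed

section \<open>Layer cake comparison of truncated differences\<close>

lemma sigma_finite_lebesgue: "sigma_finite_measure (lebesgue :: real measure)"
proof
  show "\<exists>A::real set set. countable A \<and> A \<subseteq> sets lebesgue \<and> \<Union>A = space lebesgue \<and>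
      (\<forall>a\<in>A. emeasure lebesgue a \<noteq> \<infinity>)"
  proof (intro exI[of _ "range (\<lambda>n::nat. {- real n..real n})"] conjI)
    show "\<Union> (range (\<lambda>n::nat. {- real n..real n})) = space lebesgue"
    proof -
      have "\<exists>n::nat. - real n \<le> x \<and> x \<le> real n" for x
        by (metis abs_le_iff minus_le_iff real_arch_simple)
      then show ?thesis by auto
    qed
  qed auto
qed

text \<open>Subtraction in \<open>ennreal\<close> truncates at 0, so the integrand is the length of
  the set of all \<open>u\<close> between \<open>q t\<close> and \<open>p t\<close>. The values of
  \<open>p\<close> are extended because \<open>f\<^sup>*\<close> may be infinite; those of
  \<open>q\<close> are real, so that no difference of infinities occurs.\<close>

lemma nn_integral_truncated_diff:
  fixes p :: "real \<Rightarrow> ennreal" and q :: "real \<Rightarrow> real"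
  assumes I: "I \<in> sets lebesgue"
    and p [measurable]: "p \<in> borel_measurable (lebesgue_on I)"
    and q [measurable]: "q \<in> borel_measurable (lebesgue_on I)" and "\<And>t. t \<in> I \<Longrightarrow> 0 \<le> q t"
  shows "(\<integral>\<^sup>+ t. (p t - ennreal (q t)) \<partial>lebesgue_on I) =
    (\<integral>\<^sup>+ u. emeasure lebesgue {t \<in> I. q t \<le> u \<and> ennreal u < p t} \<partial>lborel)"
proof -
  have layer: "x - ennreal y = (\<integral>\<^sup>+ u. indicator {u. y \<le> u \<and> ennreal u < x} u \<partial>lborel)"
    if "0 \<le> y" for x y
  proof (cases x)
    case (real r)
    then have "{u. y \<le> u \<and> ennreal u < x} = {y..<r}"
      using that by (auto simp: ennreal_less_iff)
    then show ?thesis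
      using that real by (cases "y \<le> r") (auto simp: ennreal_minus ennreal_neg)
  next
    case top
    then have "{u. y \<le> u \<and> ennreal u < x} = {y..}" by auto
    moreover have "emeasure lborel {y..} = \<infinity>" using emeasure_lebesgue_atLeast[of y] by simp
    ultimately show ?thesis using top by simp
  qed
  interpret lebesgue_on: sigma_finite_measure "lebesgue_on I"
    by (intro sigma_finite_measure_restrict_space sigma_finite_lebesgue I)
  interpret pair_sigma_finite "lebesgue_on I" lborel ..
  have "(\<integral>\<^sup>+ t. (p t - ennreal (q t)) \<partial>lebesgue_on I) =
      (\<integral>\<^sup>+ t. (\<integral>\<^sup>+ u. indicator {u. q t \<le> u \<and> ennreal u < p t} u \<partial>lborel) \<partial>lebesgue_on I)"
    using assms by (intro nn_integral_cong layer) simp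
  \<comment> \<open>Rewritten as the indicator of one subset of the product space, whose
    measurability is what Tonelli's theorem requires.\<close>
  also have "\<dots> = (\<integral>\<^sup>+ t. (\<integral>\<^sup>+ u. indicator {x \<in> space (lebesgue_on I \<Otimes>\<^sub>M lborel).
      q (fst x) \<le> snd x \<and> ennreal (snd x) < p (fst x)} (t, u) \<partial>lborel) \<partial>lebesgue_on I)"
    by (intro nn_integral_cong) (auto simp: indicator_def space_pair_measure)
  also have "\<dots> = (\<integral>\<^sup>+ u. (\<integral>\<^sup>+ t. indicator {x \<in> space (lebesgue_on I \<Otimes>\<^sub>M lborel).
      q (fst x) \<le> snd x \<and> ennreal (snd x) < p (fst x)} (t, u) \<partial>lebesgue_on I) \<partial>lborel)"
    by (intro Fubini'[symmetric]) measurable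
  also have "\<dots> = (\<integral>\<^sup>+ u. (\<integral>\<^sup>+ t. indicator {t \<in> I. q t \<le> u \<and> ennreal u < p t} t \<partial>lebesgue_on I) \<partial>lborel)"
    by (intro nn_integral_cong) (auto simp: indicator_def space_pair_measure)
  also have "\<dots> = (\<integral>\<^sup>+ u. emeasure lebesgue {t \<in> I. q t \<le> u \<and> ennreal u < p t} \<partial>lborel)"
  proof (intro nn_integral_cong)
    fix u :: real
    have "{t \<in> space (lebesgue_on I). q t \<le> u \<and> ennreal u < p t} \<in> sets (lebesgue_on I)"
      by measurable
    then show "(\<integral>\<^sup>+ t. indicator {t \<in> I. q t \<le> u \<and> ennreal u < p t} t \<partial>lebesgue_on I) =
        emeasure lebesgue {t \<in> I. q t \<le> u \<and> ennreal u < p t}"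
      using I by (simp add: emeasure_restrict_space)
  qed
  finally show ?thesis .
qed

lemma nn_integral_truncated_diff_le:
  fixes a :: ereal and s :: real
  defines "I \<equiv> einterval 0 a"
  assumes a: "0 < a" and w: "weight_function I w" and f: "f \<in> L0 I"
    and v: "v \<in> L0 I" "equimeasurable I v w" "\<And>t. t \<in> I \<Longrightarrow> 0 \<le> v t" and s: "0 < s"
  shows "(\<integral>\<^sup>+ t. (rearrangement I f t - ennreal (s * w t)) \<partial>lebesgue_on I) \<le>
    (\<integral>\<^sup>+ t. (ennreal \<bar>f t\<bar> - ennreal (s * v t)) \<partial>lebesgue_on I)"
proof -
  have I: "I \<in> sets lebesgue" by (simp add: I_def)
  have wL0: "w \<in> L0 I" and w0: "\<And>t. t \<in> I \<Longrightarrow> 0 \<le> w t"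
    using w by (auto simp: weight_function_def)
  have [measurable]: "w \<in> borel_measurable (lebesgue_on I)" "v \<in> borel_measurable (lebesgue_on I)"
      "f \<in> borel_measurable (lebesgue_on I)"
    using wL0 v f by (auto simp: L0_def)
  have [measurable]: "rearrangement I f \<in> borel_measurable (lebesgue_on I)"
    by (rule borel_measurable_rearrangement[OF I f])
  have "emeasure lebesgue {t \<in> I. s * w t \<le> u \<and> ennreal u < rearrangement I f t} \<le>
      emeasure lebesgue {t \<in> I. s * v t \<le> u \<and> ennreal u < ennreal \<bar>f t\<bar>}" for u
  proof (cases "0 \<le> u")
    case u: True
    let ?W = "{t \<in> I. s * w t \<le> u \<and> ennreal u < rearrangement I f t}"
    define c where "c = distribution_fun I w (u / s)"
    have "distribution_fun I v (u / s) = distribution_fun I w (u / s)"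
      using equimeasurable_einterval_iff[OF a, of v w] v wL0 u s by (simp add: I_def)
    then have cv: "c = emeasure lebesgue {t \<in> I. u / s < \<bar>v t\<bar>}"
      by (simp add: c_def distribution_fun_def)
    \<comment> \<open>The level set lies between \<open>c\<close> and
      \<open>distribution_fun I f u\<close>: as \<open>w\<close> decreases, all points where it
      exceeds \<open>u / s\<close> lie to the left of each point of the level set.\<close>
    have W: "c \<le> ennreal t" "ennreal t < distribution_fun I f u" "0 < t" if "t \<in> ?W" for t
    proof -
      show "0 < t" using that by (auto simp: I_def einterval_iff)
      show "ennreal t < distribution_fun I f u"
        using that less_rearrangement_iff[OF I f u] by auto
      have "{t' \<in> I. u / s < \<bar>w t'\<bar>} \<subseteq> {0<..<t}"
      proof
        fix t' assume t': "t' \<in> {t' \<in> I. u / s < \<bar>w t'\<bar>}"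
        then have "s * w t \<le> u" "u < s * w t'"
          using that w0[of t'] s by (auto simp: divide_less_eq mult.commute)
        then have "s * w t < s * w t'" by simp
        then have "w t < w t'" using s by simp
        moreover have "w t' \<le> w t" if "t \<le> t'"
          using w t' that \<open>t \<in> ?W\<close> by (auto simp: weight_function_def intro: monotone_onD)
        ultimately have "t' < t" by (meson leD leI)
        with t' show "t' \<in> {0<..<t}" by (auto simp: I_def einterval_iff)
      qed
      then have "c \<le> emeasure lebesgue {0<..<t}"
        unfolding c_def distribution_fun_def by (intro emeasure_mono) auto
      with \<open>0 < t\<close> show "c \<le> ennreal t" by simp
    qed
    show ?thesis
    proof (cases "?W = {}")
      case False
      then obtain t where "t \<in> ?W" by blast
      then have "c \<le> ennreal t" by (rule W(1))
      \<comment> \<open>A single point of the level set bounds \<open>c\<close>, which makes the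
        subtraction of \<open>c\<close> meaningful.\<close>
      then have c: "c < \<infinity>" by (simp add: le_less_trans)
      define c' where "c' = enn2real c"
      have c': "c = ennreal c'" "0 \<le> c'" using c by (auto simp: c'_def)
      have "emeasure lebesgue ?W \<le> distribution_fun I f u - c"
      proof (cases "distribution_fun I f u")
        case (real d)
        have "?W \<subseteq> {c'..<d}"
          using W c' real by (force simp: ennreal_less_iff)
        then have "emeasure lebesgue ?W \<le> emeasure lebesgue {c'..<d}"
          by (intro emeasure_mono) auto
        also have "\<dots> \<le> distribution_fun I f u - c"
          using real c' by (cases "c' \<le> d") (auto simp: ennreal_minus)
        finally show ?thesis .
      next
        case top
        then show ?thesis using c' by simp
      qed
      \<comment> \<open>By equimeasurability the removed set has measure \<open>c\<close>, so its
        removal lowers the measure by at most \<open>c\<close>.\<close>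
      also have "\<dots> \<le> emeasure lebesgue ({t \<in> I. u < \<bar>f t\<bar>} - {t \<in> I. u / s < \<bar>v t\<bar>})"
      proof -
        have "distribution_fun I f u \<le> emeasure lebesgue
            (({t \<in> I. u < \<bar>f t\<bar>} - {t \<in> I. u / s < \<bar>v t\<bar>}) \<union> {t \<in> I. u / s < \<bar>v t\<bar>})"
          unfolding distribution_fun_def using I f v
          by (intro emeasure_mono sets.Un sets.Diff L0_sets_greater) auto
        also have "\<dots> \<le> emeasure lebesgue ({t \<in> I. u < \<bar>f t\<bar>} - {t \<in> I. u / s < \<bar>v t\<bar>}) + c"
          unfolding cv using I f v by (intro emeasure_subadditive sets.Diff L0_sets_greater)
        finally show ?thesis
          using c' by (simp add: add.commute ennreal_minus_le_iff)
      qed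
      also have "{t \<in> I. u < \<bar>f t\<bar>} - {t \<in> I. u / s < \<bar>v t\<bar>} =
          {t \<in> I. s * v t \<le> u \<and> ennreal u < ennreal \<bar>f t\<bar>}"
        using u s v by (auto simp: ennreal_less_iff field_simps)
      finally show ?thesis .
    next
      case True
      then show ?thesis by (simp only: emeasure_empty zero_le)
    qed
  next
    case False
    then have "s * w t > u" if "t \<in> I" for t
      using w0[OF that] s by (smt (verit) mult_nonneg_nonneg)
    then have "{t \<in> I. s * w t \<le> u \<and> ennreal u < rearrangement I f t} = {}"
      by (auto simp: not_le)
    then show ?thesis by (simp only: emeasure_empty zero_le)
  qed
  moreover have "(\<integral>\<^sup>+ t. (rearrangement I f t - ennreal (s * w t)) \<partial>lebesgue_on I) =
      (\<integral>\<^sup>+ u. emeasure lebesgue {t \<in> I. s * w t \<le> u \<and> ennreal u < rearrangement I f t} \<partial>lborel)"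
    using s w0 by (intro nn_integral_truncated_diff I) auto
  moreover have "(\<integral>\<^sup>+ t. (ennreal \<bar>f t\<bar> - ennreal (s * v t)) \<partial>lebesgue_on I) =
      (\<integral>\<^sup>+ u. emeasure lebesgue {t \<in> I. s * v t \<le> u \<and> ennreal u < ennreal \<bar>f t\<bar>} \<partial>lborel)"
    using s v by (intro nn_integral_truncated_diff I) auto
  ultimately show ?thesis
    by (simp add: nn_integral_mono)
qed

section \<open>The lower bound\<close>

lemma orlicz_function_D:
  assumes "orlicz_function \<phi>"
  shows "\<phi> 0 = 0" "0 \<le> x \<Longrightarrow> 0 \<le> \<phi> x" "0 \<le> x \<Longrightarrow> x \<le> y \<Longrightarrow> \<phi> x \<le> \<phi> y"
    "0 \<le> x \<Longrightarrow> x < y \<Longrightarrow> \<phi> x < \<phi> y" "convex_on {0..} \<phi>"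
  using assms unfolding orlicz_function_def
  by (auto simp: strict_mono_on_def Pi_iff order_le_less)

lemma orlicz_function_pos:
  assumes "orlicz_function \<phi>" "0 < x"
  shows "0 < \<phi> x"
  using orlicz_function_D(1)[OF assms(1)] orlicz_function_D(4)[OF assms(1), of 0 x] assms(2) by simp

lemma continuous_on_orlicz_function:
  assumes "orlicz_function \<phi>"
  shows "continuous_on {0<..} \<phi>"
  by (rule convex_on_continuous) 
    (auto intro: convex_on_subset[OF orlicz_function_D(5)[OF assms]])

text \<open>The second differences are the masses, at the nodes of a mesh of width \<open>h\<close>, of the
  measure \<open>d\<phi>'\<close> in \<open>\<phi> x = \<integral> (x - s)\<^sub>+ d\<phi>' s\<close>. At \<open>k = 0\<close> the truncated \<open>k - 1\<close> makes it \<open>\<phi> h / h\<close>, the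
  mass of \<open>\<phi>'\<close> at the origin.\<close>

definition second_diff :: "(real \<Rightarrow> real) \<Rightarrow> real \<Rightarrow> nat \<Rightarrow> real" where
  "second_diff \<phi> h k = (\<phi> (real (k + 1) * h) - 2 * \<phi> (real k * h) + \<phi> (real (k - 1) * h)) / h"

lemma second_diff_nonneg:
  assumes \<phi>: "orlicz_function \<phi>" and h: "0 < h"
  shows "0 \<le> second_diff \<phi> h k"
proof (cases k)
  case 0
  then show ?thesis
    using h orlicz_function_D(1,2)[OF \<phi>] by (simp add: second_diff_def)
next
  case (Suc m)
  have "\<phi> ((1 - 1 / 2) *\<^sub>R (real m * h) + (1 / 2) *\<^sub>R (real (m + 2) * h)) \<le>
      (1 - 1 / 2) * \<phi> (real m * h) + 1 / 2 * \<phi> (real (m + 2) * h)"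
    using h by (intro convex_onD[OF orlicz_function_D(5)[OF \<phi>]]) auto
  also have "(1 - 1 / 2) *\<^sub>R (real m * h) + (1 / 2) *\<^sub>R (real (m + 2) * h) = real (m + 1) * h"
    by (simp add: field_simps)
  finally show ?thesis
    using h Suc by (simp add: second_diff_def add.commute)
qed

text \<open>The discrete form of \<open>\<phi> x = \<integral> (x - s)\<^sub>+ d\<phi>' s\<close>,
  exact at the nodes. Summing second differences once gives the backward first difference; summing
  twice gives \<open>\<phi>\<close>, as \<open>\<phi> 0 = 0\<close>.\<close>

lemma sum_second_diff:
  assumes \<phi>: "orlicz_function \<phi>" and h: "0 < h"
  shows "(\<Sum>k<j. second_diff \<phi> h k * (real j - real k) * h) = \<phi> (real j * h)"
proof -
  have first: "(\<Sum>k<j. second_diff \<phi> h k * h) = \<phi> (real j * h) - \<phi> (real (j - 1) * h)" for j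
  proof (induction j)
    case (Suc j)
    then show ?case using h by (simp add: second_diff_def)
  qed simp
  show ?thesis
  proof (induction j)
    case 0
    then show ?case using orlicz_function_D(1)[OF \<phi>] by simp
  next
    case (Suc j)
    \<comment> \<open>Passing from \<open>j\<close> to \<open>Suc j\<close> raises every weight by
      \<open>h\<close>; the new term \<open>k = j\<close> has weight 0 in the old weighting.\<close>
    have "(\<Sum>k<Suc j. second_diff \<phi> h k * (real (Suc j) - real k) * h) =
        (\<Sum>k<Suc j. second_diff \<phi> h k * (real j - real k) * h) + (\<Sum>k<Suc j. second_diff \<phi> h k * h)"
      unfolding sum.distrib[symmetric] by (intro sum.cong) (auto simp: algebra_simps)
    then show ?case using Suc first[of "Suc j"] by simp
  qed
qed

text \<open>The nodes are shifted by one step of the mesh, so that the sum stays below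
  \<open>\<phi> (x / y) * y\<close>.\<close>

definition truncated_sum :: "(real \<Rightarrow> real) \<Rightarrow> real \<Rightarrow> ennreal \<Rightarrow> real \<Rightarrow> ennreal" where
  "truncated_sum \<phi> h x y =
     (\<Sum>k. ennreal (second_diff \<phi> h k) * (x - ennreal (real (k + 1) * h * y)))"

text \<open>Let \<open>j * h\<close> be the last node not above \<open>g / v\<close>. Since
  \<open>g\<close> is at most \<open>(j + 1) * h * v\<close>, the shift by one step leaves each
  difference at most \<open>(j - k) * h * v\<close>, and the sum at most
  \<open>\<phi> (j * h) * v\<close>.\<close>

lemma truncated_sum_le_orlicz_term:
  assumes \<phi>: "orlicz_function \<phi>" and h: "0 < h" and "0 \<le> g" "0 \<le> v"
  shows "truncated_sum \<phi> h (ennreal g) v \<le> orlicz_term \<phi> (ennreal g) v"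
proof (cases "v = 0")
  case True
  then show ?thesis by (auto simp: truncated_sum_def orlicz_term_def)
next
  case False
  with \<open>0 \<le> v\<close> have v: "0 < v" by simp
  define j where "j = nat \<lfloor>g / v / h\<rfloor>"
  have "real j \<le> g / v / h" "g / v / h < real j + 1"
    unfolding j_def using assms v by auto
  then have j: "real j * h \<le> g / v" "g \<le> (real j + 1) * h * v"
    using h v by (auto simp: field_simps)
  have "truncated_sum \<phi> h (ennreal g) v =
      (\<Sum>k<j. ennreal (second_diff \<phi> h k) * (ennreal g - ennreal (real (k + 1) * h * v)))"
    unfolding truncated_sum_def
  proof (rule suminf_finite)
    fix k assume "k \<notin> {..<j}"
    then have "(real j + 1) * (h * v) \<le> real (k + 1) * (h * v)"
      using h v by (intro mult_right_mono) auto
    with j have "g \<le> real (k + 1) * h * v" by (simp add: mult.assoc)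
    then show "ennreal (second_diff \<phi> h k) * (ennreal g - ennreal (real (k + 1) * h * v)) = 0"
      using \<open>0 \<le> g\<close> h v by (simp add: ennreal_minus ennreal_neg)
  qed simp
  also have "\<dots> \<le> (\<Sum>k<j. ennreal (second_diff \<phi> h k * (real j - real k) * h * v))"
  proof (rule sum_mono)
    fix k assume "k \<in> {..<j}"
    have "ennreal g - ennreal (real (k + 1) * h * v) = ennreal (g - real (k + 1) * h * v)"
      using \<open>0 \<le> g\<close> h v by (simp add: ennreal_minus)
    also have "\<dots> \<le> ennreal ((real j - real k) * h * v)"
      using j by (intro ennreal_leI) (simp add: algebra_simps)
    finally have "ennreal (second_diff \<phi> h k) * (ennreal g - ennreal (real (k + 1) * h * v)) \<le>
        ennreal (second_diff \<phi> h k) * ennreal ((real j - real k) * h * v)"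
      by (rule mult_left_mono) simp
    also have "\<dots> = ennreal (second_diff \<phi> h k * (real j - real k) * h * v)"
      using second_diff_nonneg[OF \<phi> h] \<open>k \<in> {..<j}\<close> h v
      by (subst ennreal_mult[symmetric]) (auto simp: mult.assoc)
    finally show "ennreal (second_diff \<phi> h k) * (ennreal g - ennreal (real (k + 1) * h * v)) \<le>
        ennreal (second_diff \<phi> h k * (real j - real k) * h * v)" .
  qed
  also have "\<dots> = ennreal (\<Sum>k<j. second_diff \<phi> h k * (real j - real k) * h * v)"
    using second_diff_nonneg[OF \<phi> h] h v by (intro sum_ennreal) auto
  also have "(\<Sum>k<j. second_diff \<phi> h k * (real j - real k) * h * v) = \<phi> (real j * h) * v"
    using sum_second_diff[OF \<phi> h, of j] by (simp flip: sum_distrib_right)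
  also have "ennreal (\<phi> (real j * h) * v) \<le> ennreal (\<phi> (g / v) * v)"
    using j h v orlicz_function_D(3)[OF \<phi>] by (intro ennreal_leI mult_right_mono) auto
  also have "\<dots> = orlicz_term \<phi> (ennreal g) v"
    using False \<open>0 \<le> g\<close> by (auto simp: orlicz_term_def)
  finally show ?thesis .
qed

text \<open>The \<open>2 * h\<close> collects two losses of one mesh step each: rounding
  \<open>g / v\<close> down to a node, and the shift of the nodes. The \<open>max 0\<close> keeps
  the argument in the domain of \<open>\<phi>\<close>.\<close>

lemma le_truncated_sum:
  assumes \<phi>: "orlicz_function \<phi>" and h: "0 < h" and "0 \<le> g" and v: "0 < v"
  shows "ennreal (\<phi> (max 0 (g / v - 2 * h)) * v) \<le> truncated_sum \<phi> h (ennreal g) v"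
proof -
  define j where "j = nat \<lfloor>g / v / h\<rfloor>"
  have "real j \<le> g / v / h" "g / v / h < real j + 1"
    unfolding j_def using assms by auto
  then have j: "real j * h * v \<le> g" "g / v \<le> (real j + 1) * h"
    using h v by (auto simp: field_simps)
  show ?thesis
  proof (cases j)
    case 0
    then have "max 0 (g / v - 2 * h) = 0" using j h by simp
    then show ?thesis using orlicz_function_D(1)[OF \<phi>] by simp
  next
    case (Suc i)
    have "max 0 (g / v - 2 * h) \<le> real i * h"
      using j Suc h by (simp add: algebra_simps)
    then have "ennreal (\<phi> (max 0 (g / v - 2 * h)) * v) \<le> ennreal (\<phi> (real i * h) * v)"
      using v orlicz_function_D(3)[OF \<phi>] by (intro ennreal_leI mult_right_mono) auto
    also have "\<phi> (real i * h) * v = (\<Sum>k<i. second_diff \<phi> h k * (real i - real k) * h * v)"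
      using sum_second_diff[OF \<phi> h, of i] by (simp flip: sum_distrib_right)
    also have "ennreal \<dots> = (\<Sum>k<i. ennreal (second_diff \<phi> h k * (real i - real k) * h * v))"
      using second_diff_nonneg[OF \<phi> h] h v by (intro sum_ennreal[symmetric]) auto
    also have "\<dots> \<le> (\<Sum>k<i. ennreal (second_diff \<phi> h k) * (ennreal g - ennreal (real (k + 1) * h * v)))"
    proof (rule sum_mono)
      fix k assume "k \<in> {..<i}"
      then have "ennreal (second_diff \<phi> h k * (real i - real k) * h * v) =
          ennreal (second_diff \<phi> h k) * ennreal ((real i - real k) * h * v)"
        using second_diff_nonneg[OF \<phi> h] h v
        by (subst ennreal_mult[symmetric]) (auto simp: mult.assoc)
      also have "\<dots> \<le> ennreal (second_diff \<phi> h k) * ennreal (g - real (k + 1) * h * v)"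
        using j Suc by (intro mult_left_mono ennreal_leI) (auto simp: algebra_simps)
      also have "ennreal (g - real (k + 1) * h * v) = ennreal g - ennreal (real (k + 1) * h * v)"
        using \<open>0 \<le> g\<close> h v by (simp add: ennreal_minus)
      finally show "ennreal (second_diff \<phi> h k * (real i - real k) * h * v) \<le>
          ennreal (second_diff \<phi> h k) * (ennreal g - ennreal (real (k + 1) * h * v))" .
    qed
    also have "\<dots> \<le> truncated_sum \<phi> h (ennreal g) v"
      unfolding truncated_sum_def by (rule sum_le_suminf) auto
    finally show ?thesis .
  qed
qed

text \<open>The one-sided bound is the form that Fatou's lemma asks for. At \<open>y = 0\<close> and
  finite \<open>x > 0\<close> it can fail: the truncated sums then equal \<open>x\<close> times the
  limiting slope of \<open>\<phi>\<close> at infinity, which may be finite.\<close>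

lemma orlicz_term_le_liminf:
  assumes \<phi>: "orlicz_function \<phi>" and "0 \<le> y" and "y = 0 \<Longrightarrow> x = 0"
  shows "orlicz_term \<phi> x y \<le> liminf (\<lambda>n. truncated_sum \<phi> (1 / real (Suc n)) x y)"
proof (cases "y = 0")
  case True
  then show ?thesis using assms(3) by (simp add: orlicz_term_def)
next
  case False
  with \<open>0 \<le> y\<close> have y: "0 < y" by simp
  show ?thesis
  proof (cases x)
    case (real g)
    define z where "z = g / y"
    have z: "0 \<le> z" using real y by (simp add: z_def)
    have "(\<lambda>n. max 0 (z - 2 * (1 / real (Suc n)))) \<longlonglongrightarrow> max 0 (z - 2 * 0)"
      by (intro tendsto_intros LIMSEQ_inverse_real_of_nat[unfolded inverse_eq_divide])
    then have lim: "(\<lambda>n. max 0 (z - 2 * (1 / real (Suc n)))) \<longlonglongrightarrow> z"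
      using z by simp
    \<comment> \<open>Continuity is used only at positive points; for \<open>z = 0\<close> the
      sequence is constant.\<close>
    have "(\<lambda>n. \<phi> (max 0 (z - 2 * (1 / real (Suc n))))) \<longlonglongrightarrow> \<phi> z"
    proof (cases "z = 0")
      case True
      then show ?thesis by simp
    next
      case False
      then have "isCont \<phi> z"
        using z continuous_on_orlicz_function[OF \<phi>] continuous_on_eq_continuous_at[of "{0<..}" \<phi>]
        by (simp add: open_greaterThan)
      then show ?thesis by (rule isCont_tendsto_compose[OF _ lim])
    qed
    then have "(\<lambda>n. ennreal (\<phi> (max 0 (z - 2 * (1 / real (Suc n)))) * y)) \<longlonglongrightarrow> ennreal (\<phi> z * y)"
      by (intro tendsto_ennrealI tendsto_intros)
    then have "ennreal (\<phi> z * y) = liminf (\<lambda>n. ennreal (\<phi> (max 0 (z - 2 * (1 / real (Suc n)))) * y))"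
      by (rule lim_imp_Liminf[OF sequentially_bot, symmetric])
    also have "\<dots> \<le> liminf (\<lambda>n. truncated_sum \<phi> (1 / real (Suc n)) x y)"
      unfolding z_def real using real y by (intro Liminf_mono always_eventually allI le_truncated_sum[OF \<phi>]) auto
    finally show ?thesis
      using False real by (simp add: orlicz_term_def z_def)
  next
    case top
    have "truncated_sum \<phi> (1 / real (Suc n)) x y = \<infinity>" for n
    proof -
      let ?h = "1 / real (Suc n)"
      \<comment> \<open>The mass at the origin, \<open>\<phi> h / h\<close>, is positive, so the
        first term alone is infinite.\<close>
      have "0 < second_diff \<phi> ?h 0"
        using orlicz_function_pos[OF \<phi>, of ?h] orlicz_function_D(1)[OF \<phi>]
        by (simp add: second_diff_def)
      then have "\<infinity> = (\<Sum>k<1. ennreal (second_diff \<phi> ?h k) * (x - ennreal (real (k + 1) * ?h * y)))"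
        using top by (simp add: ennreal_mult_eq_top_iff ennreal_mult_top)
      also have "\<dots> \<le> truncated_sum \<phi> ?h x y"
        unfolding truncated_sum_def by (rule sum_le_suminf) auto
      finally show ?thesis by (simp add: top_unique)
    qed
    then show ?thesis by (simp add: Liminf_const)
  qed
qed

lemma borel_measurable_orlicz_term [measurable]:
  assumes \<phi>: "orlicz_function \<phi>"
    and [measurable]: "p \<in> borel_measurable M" "q \<in> borel_measurable M"
    and q: "\<And>t. t \<in> space M \<Longrightarrow> 0 \<le> q t"
  shows "(\<lambda>t. orlicz_term \<phi> (p t) (q t)) \<in> borel_measurable M"
proof -
  \<comment> \<open>On negative numbers \<open>\<phi>\<close> is arbitrary; composed with
    \<open>max 0\<close> it is monotone on the whole line, hence Borel.\<close>
  have "mono (\<lambda>x. \<phi> (max 0 x))"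
    by (rule monoI) (auto intro: orlicz_function_D(3)[OF \<phi>])
  then have [measurable]: "(\<lambda>x. \<phi> (max 0 x)) \<in> borel_measurable borel"
    by (rule borel_measurable_mono)
  have "(\<lambda>t. if p t = \<infinity> then \<infinity> else if q t = 0 then (if p t = 0 then 0 else \<infinity>)
      else ennreal (\<phi> (max 0 (enn2real (p t) / q t)) * q t)) \<in> borel_measurable M"
    by measurable
  then show ?thesis
    by (rule measurable_cong[THEN iffD1, rotated]) (use q in \<open>auto simp: orlicz_term_def max_def\<close>)
qed

text \<open>The truncated sums are compared node by node. On the side of \<open>v\<close> they must
  lie below the integrand, which the shifted nodes ensure; on the side of \<open>f\<^sup>*\<close>
  only their limit matters.\<close>

lemma orlicz_integral_rearrangement_le:
  fixes a :: ereal
  defines "I \<equiv> einterval 0 a"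
  assumes \<phi>: "orlicz_function \<phi>" and a: "0 < a" and w: "weight_function I w" and f: "f \<in> L0 I"
    and v: "v \<in> L0 I" "equimeasurable I v w" "\<And>t. t \<in> I \<Longrightarrow> 0 \<le> v t"
  shows "orlicz_integral \<phi> I (rearrangement I f) w \<le> orlicz_integral \<phi> I (\<lambda>t. ennreal \<bar>f t\<bar>) v"
proof (cases "orlicz_integral \<phi> I (\<lambda>t. ennreal \<bar>f t\<bar>) v = \<infinity>")
  case False
  have I: "I \<in> sets lebesgue" by (simp add: I_def)
  have wL0: "w \<in> L0 I" and w0: "\<And>t. t \<in> I \<Longrightarrow> 0 \<le> w t"
    using w by (auto simp: weight_function_def)
  have [measurable]: "w \<in> borel_measurable (lebesgue_on I)" "v \<in> borel_measurable (lebesgue_on I)"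
      "f \<in> borel_measurable (lebesgue_on I)"
    using wL0 v f by (auto simp: L0_def)
  have [measurable]: "rearrangement I f \<in> borel_measurable (lebesgue_on I)"
    by (rule borel_measurable_rearrangement[OF I f])
  \<comment> \<open>A finite integral forces \<open>f\<close> to vanish almost everywhere on the
    zeros of \<open>v\<close>, so the support of \<open>f\<close> is no larger in measure than that
    of \<open>v\<close>, hence of \<open>w\<close>.\<close>
  have "AE t in lebesgue_on I. orlicz_term \<phi> (ennreal \<bar>f t\<bar>) (v t) \<noteq> \<infinity>"
    using False v unfolding orlicz_integral_def
    by (intro nn_integral_PInf_AE borel_measurable_orlicz_term[OF \<phi>]) auto
  then have ae: "AE t in lebesgue_on I. 0 < \<bar>f t\<bar> \<longrightarrow> 0 < \<bar>v t\<bar>"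
    by eventually_elim (auto simp: orlicz_term_def split: if_splits)
  have "distribution_fun I f 0 \<le> distribution_fun I v 0"
  proof -
    have "emeasure (lebesgue_on I) {t \<in> I. 0 < \<bar>f t\<bar>} \<le> emeasure (lebesgue_on I) {t \<in> I. 0 < \<bar>v t\<bar>}"
      using ae L0_sets_greater[OF I v(1), of 0] I
      by (intro emeasure_mono_AE) (auto simp: sets_restrict_space_iff)
    then show ?thesis
      using I f v by (simp add: distribution_fun_def emeasure_restrict_space L0_sets_greater)
  qed
  also have "\<dots> = distribution_fun I w 0"
    using equimeasurable_einterval_iff[OF a, of v w] v wL0 by (simp add: I_def)
  finally have supp: "distribution_fun I f 0 \<le> distribution_fun I w 0" .
  \<comment> \<open>Where a weight vanishes, the convention gives \<open>\<infinity>\<close> instead of the limit of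
    \<open>\<phi> (x / y) * y\<close> as \<open>y\<close> tends to \<open>0\<close>; approximation by truncated sums fails there unless \<open>x = 0\<close>.\<close>
  have vanish: "rearrangement I f t = 0" if "t \<in> I" "w t = 0" for t
  proof (rule ccontr)
    assume "rearrangement I f t \<noteq> 0"
    then have "ennreal t < distribution_fun I f 0"
      using less_rearrangement_iff[OF I f order_refl, of t] by (simp add: zero_less_iff_neq_zero)
    also have "\<dots> \<le> distribution_fun I w 0" by (rule supp)
    also have "\<dots> \<le> emeasure lebesgue {0<..<t}"
      unfolding distribution_fun_def
    proof (intro emeasure_mono subsetI)
      fix t' assume t': "t' \<in> {t \<in> I. 0 < \<bar>w t\<bar>}"
      have "w t' \<le> w t" if "t \<le> t'"
        using w t' that \<open>t \<in> I\<close> by (auto simp: weight_function_def intro: monotone_onD)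
      with t' w0 \<open>w t = 0\<close> have "t' < t" by force
      with t' show "t' \<in> {0<..<t}" by (auto simp: I_def einterval_iff)
    qed simp
    also have "\<dots> = ennreal t" using that by (simp add: I_def einterval_iff)
    finally show False by simp
  qed
  define Q where "Q n = truncated_sum \<phi> (1 / real (Suc n))" for n
  have Qint: "(\<integral>\<^sup>+ t. Q n (rearrangement I f t) (w t) \<partial>lebesgue_on I) \<le>
      orlicz_integral \<phi> I (\<lambda>t. ennreal \<bar>f t\<bar>) v" for n
  proof -
    let ?h = "1 / real (Suc n)"
    have Q_suminf: "(\<integral>\<^sup>+ t. Q n (p t) (q t) \<partial>lebesgue_on I) = (\<Sum>k. ennreal (second_diff \<phi> ?h k) *
        (\<integral>\<^sup>+ t. p t - ennreal (real (k + 1) * ?h * q t) \<partial>lebesgue_on I))"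
      if [measurable]: "p \<in> borel_measurable (lebesgue_on I)" "q \<in> borel_measurable (lebesgue_on I)" for p q
      unfolding Q_def truncated_sum_def
      by (subst nn_integral_suminf) (auto simp: nn_integral_cmult)
    have "(\<integral>\<^sup>+ t. Q n (rearrangement I f t) (w t) \<partial>lebesgue_on I) \<le>
        (\<integral>\<^sup>+ t. Q n (ennreal \<bar>f t\<bar>) (v t) \<partial>lebesgue_on I)"
    proof (subst (1 2) Q_suminf)
      have "(\<integral>\<^sup>+ t. rearrangement I f t - ennreal (real (k + 1) * ?h * w t) \<partial>lebesgue_on I) \<le>
          (\<integral>\<^sup>+ t. ennreal \<bar>f t\<bar> - ennreal (real (k + 1) * ?h * v t) \<partial>lebesgue_on I)" for k
        unfolding I_def
        by (rule nn_integral_truncated_diff_le[OF a]) (use w f v in \<open>auto simp flip: I_def\<close>)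
      then show "(\<Sum>k. ennreal (second_diff \<phi> ?h k) *
          (\<integral>\<^sup>+ t. rearrangement I f t - ennreal (real (k + 1) * ?h * w t) \<partial>lebesgue_on I)) \<le>
          (\<Sum>k. ennreal (second_diff \<phi> ?h k) *
          (\<integral>\<^sup>+ t. ennreal \<bar>f t\<bar> - ennreal (real (k + 1) * ?h * v t) \<partial>lebesgue_on I))"
        by (intro suminf_le mult_left_mono) auto
    qed auto
    also have "\<dots> \<le> orlicz_integral \<phi> I (\<lambda>t. ennreal \<bar>f t\<bar>) v"
      unfolding orlicz_integral_def Q_def
      using v by (intro nn_integral_mono truncated_sum_le_orlicz_term[OF \<phi>]) auto
    finally show ?thesis .
  qed
  \<comment> \<open>The meshes are not nested, so Fatou's lemma takes the place of monotone
    convergence.\<close>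
  have "orlicz_integral \<phi> I (rearrangement I f) w \<le>
      (\<integral>\<^sup>+ t. liminf (\<lambda>n. Q n (rearrangement I f t) (w t)) \<partial>lebesgue_on I)"
    unfolding orlicz_integral_def Q_def
    using w0 vanish by (intro nn_integral_mono orlicz_term_le_liminf[OF \<phi>]) auto
  also have "\<dots> \<le> liminf (\<lambda>n. \<integral>\<^sup>+ t. Q n (rearrangement I f t) (w t) \<partial>lebesgue_on I)"
    unfolding Q_def truncated_sum_def by (intro nn_integral_liminf) measurable
  also have "\<dots> \<le> orlicz_integral \<phi> I (\<lambda>t. ennreal \<bar>f t\<bar>) v"
    using Liminf_mono[of "\<lambda>n. \<integral>\<^sup>+ t. Q n (rearrangement I f t) (w t) \<partial>lebesgue_on I"
        "\<lambda>_. orlicz_integral \<phi> I (\<lambda>t. ennreal \<bar>f t\<bar>) v" sequentially] Qint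
    by (simp add: Liminf_const)
  finally show ?thesis .
qed simp

section \<open>Ryff's measure preserving map\<close>

text \<open>The measure of the part of \<open>B\<close> to the left of \<open>y\<close> is
  1-Lipschitz in \<open>y\<close>, so the intermediate value theorem applies. This cuts a prescribed
  measure off a set of ties.\<close>

lemma ex_emeasure_Int_lessThan_eq:
  fixes B :: "real set"
  assumes B: "B \<in> sets lebesgue" "B \<subseteq> {0..}" and m: "0 \<le> m" "ennreal m < emeasure lebesgue B"
  shows "\<exists>y. emeasure lebesgue (B \<inter> {..<y}) = ennreal m"
proof -
  define F where "F y = measure lebesgue (B \<inter> {..<y})" for y
  have fm: "B \<inter> {..<y} \<in> lmeasurable" for y
  proof (rule fmeasurableI2)
    show "{0..y} \<in> lmeasurable" by simp
  qed (use B in auto)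
  have step: "F y \<le> F z" "F z \<le> F y + (z - y)" if "y \<le> z" for y z
  proof -
    show "F y \<le> F z"
      unfolding F_def using fm that by (intro measure_mono_fmeasurable) (auto simp: fmeasurableD)
    have "{y..<z} \<in> lmeasurable" by (rule fmeasurableI) (use that in auto)
    then have "F z \<le> measure lebesgue ((B \<inter> {..<y}) \<union> {y..<z})"
      unfolding F_def using fm that
      by (intro measure_mono_fmeasurable fmeasurable.Un) (auto simp: fmeasurableD)
    also have "\<dots> \<le> F y + measure lebesgue {y..<z}"
      unfolding F_def using fm[of y] by (intro measure_Un_le) (auto simp: fmeasurableD)
    finally show "F z \<le> F y + (z - y)" using that by simp
  qed
  have "\<bar>F y - F z\<bar> \<le> \<bar>y - z\<bar>" for y z
    using step[of y z] step[of z y] by (cases "y \<le> z") auto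
  then have "1-lipschitz_on UNIV F"
    by (auto simp: lipschitz_on_def dist_real_def)
  then have cont: "continuous_on UNIV F" by (rule lipschitz_on_continuous_on)
  have "(SUP n. emeasure lebesgue (B \<inter> {..<real n})) = emeasure lebesgue (\<Union>n. B \<inter> {..<real n})"
    using B by (intro SUP_emeasure_incseq) (auto simp: incseq_def)
  also have "(\<Union>n. B \<inter> {..<real n}) = B"
    using reals_Archimedean2 by auto
  finally have "ennreal m < (SUP n. emeasure lebesgue (B \<inter> {..<real n}))"
    using m(2) by (simp only:)
  then obtain n where "ennreal m < emeasure lebesgue (B \<inter> {..<real n})"
    unfolding less_SUP_iff by blast
  then have "ennreal m < ennreal (F (real n))"
    unfolding F_def by (simp add: emeasure_eq_measure2[OF fm])
  then have "m \<le> F (real n)" using m(1) by (simp add: ennreal_less_iff)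
  moreover have "F 0 = 0"
  proof -
    have "B \<inter> {..<0} = {}" using B by auto
    then show ?thesis by (simp add: F_def)
  qed
  ultimately obtain y where "F y = m"
    using IVT'[of F 0 m "real n"] m(1) cont continuous_on_subset by force
  then show ?thesis
    using emeasure_eq_measure2[OF fm, of y] unfolding F_def by metis
qed

lemma incseq_approx_below:
  fixes x :: real
  assumes "0 < x"
  obtains u where "incseq u" "\<And>n. 0 < u n" "\<And>n. u n < x" "u \<longlonglongrightarrow> x"
proof
  let ?u = "\<lambda>n. x - x / real (Suc (Suc n))"
  show "incseq ?u"
    using assms by (intro incseq_SucI) (auto intro!: divide_left_mono)
  show "0 < ?u n" "?u n < x" for n
    using assms by (auto simp: divide_less_eq)
  have "(\<lambda>n. x - x * inverse (real (Suc (Suc n)))) \<longlonglongrightarrow> x - x * 0"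
    by (intro tendsto_intros LIMSEQ_Suc[OF LIMSEQ_inverse_real_of_nat])
  then show "?u \<longlonglongrightarrow> x" by (simp add: divide_inverse)
qed

text \<open>Breaking ties in \<open>\<bar>f\<bar>\<close> by the order of the line makes the rank a measure preserving map (Ryff).\<close>

definition decr_rank :: "real set \<Rightarrow> (real \<Rightarrow> real) \<Rightarrow> real \<Rightarrow> ennreal" where
  "decr_rank I f t = emeasure lebesgue {s \<in> I. \<bar>f t\<bar> < \<bar>f s\<bar> \<or> \<bar>f s\<bar> = \<bar>f t\<bar> \<and> s < t}"

text \<open>The condition \<open>fin\<close> makes the rank finite wherever \<open>f\<close> is
  nonzero, and it allows continuity from above for superlevel sets at positive heights.\<close>

locale vanishing_at_infinity =
  fixes a :: ereal and I :: "real set" and f :: "real \<Rightarrow> real"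
  assumes a: "0 < a" and I_eq: "I = einterval 0 a" and f: "f \<in> L0 I"
    and fin: "\<And>s. 0 < s \<Longrightarrow> distribution_fun I f s < \<infinity>"
begin

lemma I [measurable, simp]: "I \<in> sets lebesgue"
  by (simp add: I_eq)

lemma measurable_f [measurable]: "f \<in> borel_measurable (lebesgue_on I)"
  using f by (simp add: L0_def)

lemma I_pos: "t \<in> I \<Longrightarrow> 0 < t"
  by (simp add: I_eq einterval_iff)

lemma measurable_id_I [measurable]: "(\<lambda>t. t) \<in> borel_measurable (lebesgue_on I)"
  by (simp add: measurable_completion measurable_restrict_space1)

lemma sets_pred: "{t \<in> I. P t} \<in> sets lebesgue" if "Measurable.pred (lebesgue_on I) P"
proof -
  have "{t \<in> space (lebesgue_on I). P t} \<in> sets (lebesgue_on I)" using that by measurable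
  then show ?thesis by (simp add: sets_restrict_space_iff)
qed

lemma rearrangement_less_top:
  assumes "0 < x"
  shows "rearrangement I f x < \<infinity>"
proof -
  have "(INF n. emeasure lebesgue {t \<in> I. real (Suc n) < \<bar>f t\<bar>}) =
      emeasure lebesgue (\<Inter>n. {t \<in> I. real (Suc n) < \<bar>f t\<bar>})"
  proof (rule INF_emeasure_decseq)
    show "range (\<lambda>n. {t \<in> I. real (Suc n) < \<bar>f t\<bar>}) \<subseteq> sets lebesgue"
      using f by (auto intro!: L0_sets_greater simp del: of_nat_Suc)
    show "decseq (\<lambda>n. {t \<in> I. real (Suc n) < \<bar>f t\<bar>})"
      by (force simp: decseq_def)
    show "emeasure lebesgue {t \<in> I. real (Suc n) < \<bar>f t\<bar>} \<noteq> \<infinity>" for n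
      using fin[of "real (Suc n)"] by (simp add: distribution_fun_def)
  qed
  also have "(\<Inter>n. {t \<in> I. real (Suc n) < \<bar>f t\<bar>}) = {}"
  proof -
    have "\<exists>n. \<not> real (Suc n) < \<bar>f t\<bar>" for t
      by (metis lessI less_le_not_le linorder_le_less_linear of_nat_less_iff order_less_trans real_arch_simple)
    then show ?thesis by blast
  qed
  finally have "(INF n. emeasure lebesgue {t \<in> I. real (Suc n) < \<bar>f t\<bar>}) < ennreal x"
    using assms by simp
  then obtain n where "distribution_fun I f (real (Suc n)) < ennreal x"
    unfolding INF_less_iff distribution_fun_def by blast
  then have "\<not> ennreal (real (Suc n)) < rearrangement I f x"
    using less_rearrangement_iff[OF I f, of "real (Suc n)" x] by auto
  then show ?thesis
    by (metis ennreal_less_top infinity_ennreal_def leI le_less_trans)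
qed

text \<open>With \<open>s0\<close> the value of \<open>f\<^sup>*\<close> at \<open>x\<close>, the
  set where \<open>\<bar>f\<bar>\<close> exceeds \<open>s0\<close> has measure at most
  \<open>x\<close>, and the set where \<open>\<bar>f\<bar>\<close> is at least \<open>s0\<close> has
  measure at least \<open>x\<close>. \<open>S\<close> is the former together with a left part of the
  ties at \<open>s0\<close>, hence an initial segment of the ranking.\<close>

lemma initial_segment:
  assumes x: "0 < x" "ennreal x \<le> emeasure lebesgue I"
  obtains S where "S \<in> sets lebesgue" "S \<subseteq> I" "emeasure lebesgue S = ennreal x"
    "\<And>t. t \<in> S \<Longrightarrow> decr_rank I f t \<le> ennreal x"
    "\<And>t. t \<in> I \<Longrightarrow> decr_rank I f t < ennreal x \<Longrightarrow> t \<in> S"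
proof -
  define s0 where "s0 = enn2real (rearrangement I f x)"
  have s0: "rearrangement I f x = ennreal s0" "0 \<le> s0"
    using rearrangement_less_top[OF x(1)] by (auto simp: s0_def)
  let ?G = "{t \<in> I. s0 < \<bar>f t\<bar>}" and ?B = "{t \<in> I. \<bar>f t\<bar> = s0}"
  have sets: "?G \<in> sets lebesgue" "?B \<in> sets lebesgue"
    by (intro sets_pred; measurable)+
  have G: "emeasure lebesgue ?G \<le> ennreal x"
    using less_rearrangement_iff[OF I f s0(2), of x] s0 by (simp add: distribution_fun_def)
  define d where "d = enn2real (emeasure lebesgue ?G)"
  have d: "emeasure lebesgue ?G = ennreal d" "0 \<le> d" "d \<le> x"
    using G x(1) by (auto simp: d_def le_less_trans enn2real_leI)
  \<comment> \<open>Continuity from above along levels that increase to \<open>s0\<close>, each of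
    them below \<open>f\<^sup>*\<close> at \<open>x\<close>.\<close>
  have GB: "ennreal x \<le> emeasure lebesgue {t \<in> I. s0 \<le> \<bar>f t\<bar>}"
  proof (cases "s0 = 0")
    case True
    then show ?thesis using x by simp
  next
    case False
    with s0 have pos: "0 < s0" by simp
    obtain u where u: "incseq u" "\<And>n. 0 < u n" "\<And>n. u n < s0" "u \<longlonglongrightarrow> s0"
      using incseq_approx_below[OF pos] by blast
    have "(INF n. emeasure lebesgue {t \<in> I. u n < \<bar>f t\<bar>}) = emeasure lebesgue (\<Inter>n. {t \<in> I. u n < \<bar>f t\<bar>})"
    proof (rule INF_emeasure_decseq)
      show "range (\<lambda>n. {t \<in> I. u n < \<bar>f t\<bar>}) \<subseteq> sets lebesgue"
        using f by (auto intro!: L0_sets_greater)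
      show "decseq (\<lambda>n. {t \<in> I. u n < \<bar>f t\<bar>})"
        using u(1) by (auto simp: decseq_def incseq_def intro: le_less_trans)
      show "emeasure lebesgue {t \<in> I. u n < \<bar>f t\<bar>} \<noteq> \<infinity>" for n
        using fin[OF u(2)[of n]] unfolding distribution_fun_def by simp
    qed
    also have "(\<Inter>n. {t \<in> I. u n < \<bar>f t\<bar>}) = {t \<in> I. s0 \<le> \<bar>f t\<bar>}"
    proof (intro equalityI subsetI)
      fix t assume t: "t \<in> (\<Inter>n. {t \<in> I. u n < \<bar>f t\<bar>})"
      have "s0 \<le> \<bar>f t\<bar>"
        by (rule LIMSEQ_le_const2[OF u(4)]) (use t in \<open>auto intro: less_imp_le\<close>)
      with t show "t \<in> {t \<in> I. s0 \<le> \<bar>f t\<bar>}" by auto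
    qed (use u(3) in \<open>auto intro: less_le_trans\<close>)
    finally have "(INF n. emeasure lebesgue {t \<in> I. u n < \<bar>f t\<bar>}) = emeasure lebesgue {t \<in> I. s0 \<le> \<bar>f t\<bar>}" .
    moreover have "ennreal x \<le> (INF n. emeasure lebesgue {t \<in> I. u n < \<bar>f t\<bar>})"
    proof (rule INF_greatest)
      fix n
      have "ennreal (u n) < rearrangement I f x"
        unfolding s0(1) using u by (intro ennreal_lessI pos) auto
      then show "ennreal x \<le> emeasure lebesgue {t \<in> I. u n < \<bar>f t\<bar>}"
        using less_rearrangement_iff[OF I f, of "u n" x] u(2)[of n]
        by (simp add: distribution_fun_def)
    qed
    ultimately show ?thesis by simp
  qed
  have "{t \<in> I. s0 \<le> \<bar>f t\<bar>} = ?G \<union> ?B" by auto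
  moreover have "emeasure lebesgue (?G \<union> ?B) = ennreal d + emeasure lebesgue ?B"
    unfolding d(1)[symmetric] by (rule plus_emeasure[symmetric]) (use sets in auto)
  ultimately have "ennreal x \<le> ennreal d + emeasure lebesgue ?B" using GB by (simp only:)
  then have B: "ennreal (x - d) \<le> emeasure lebesgue ?B"
    by (subst ennreal_minus[OF d(2), symmetric]) (simp add: ennreal_minus_le_iff)
  obtain T where T: "T \<in> sets lebesgue" "T \<subseteq> ?B" "emeasure lebesgue T = ennreal (x - d)"
    "\<And>s t. t \<in> T \<Longrightarrow> s \<in> ?B \<Longrightarrow> s < t \<Longrightarrow> s \<in> T"
  \<comment> \<open>If all ties are used up, a finite cut point need not exist.\<close>
  proof (cases "ennreal (x - d) = emeasure lebesgue ?B")
    case True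
    show ?thesis
      by (rule that[OF sets(2) subset_refl True[symmetric]])
  next
    case False
    with B have "ennreal (x - d) < emeasure lebesgue ?B" by (rule le_neq_trans)
    moreover have "?B \<subseteq> {0..}"
    proof
      fix t assume "t \<in> ?B"
      then show "t \<in> {0..}" using I_pos[of t] by simp
    qed
    moreover have "0 \<le> x - d" using d by simp
    ultimately have "\<exists>y. emeasure lebesgue (?B \<inter> {..<y}) = ennreal (x - d)"
      by (intro ex_emeasure_Int_lessThan_eq sets)
    then obtain y where y: "emeasure lebesgue (?B \<inter> {..<y}) = ennreal (x - d)" ..
    show ?thesis
    proof (rule that)
      show "?B \<inter> {..<y} \<in> sets lebesgue" by (rule sets.Int[OF sets(2)]) simp
      show "?B \<inter> {..<y} \<subseteq> ?B" by blast
      show "s \<in> ?B \<inter> {..<y}" if "t \<in> ?B \<inter> {..<y}" "s \<in> ?B" "s < t" for s t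
        using that by simp
    qed (rule y)
  qed
  define S where "S = ?G \<union> T"
  have S: "S \<in> sets lebesgue" unfolding S_def using sets(1) T(1) by (rule sets.Un)
  have mS: "emeasure lebesgue S = ennreal x"
  proof -
    have "emeasure lebesgue S = ennreal d + ennreal (x - d)"
      unfolding S_def d(1)[symmetric] T(3)[symmetric]
      by (rule plus_emeasure[symmetric]) (use sets T(1,2) in auto)
    also have "\<dots> = ennreal (d + (x - d))"
      by (rule ennreal_plus[symmetric]) (use d(2,3) in auto)
    finally show ?thesis by simp
  qed
  show ?thesis
  proof (rule that[OF S _ mS])
    show "S \<subseteq> I" using T(2) by (auto simp: S_def)
    show "decr_rank I f t \<le> ennreal x" if "t \<in> S" for t
      unfolding decr_rank_def mS[symmetric]
    proof (rule emeasure_mono[OF _ S], rule subsetI)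
      fix s assume "s \<in> {s \<in> I. \<bar>f t\<bar> < \<bar>f s\<bar> \<or> \<bar>f s\<bar> = \<bar>f t\<bar> \<and> s < t}"
      then have s: "s \<in> I" "\<bar>f t\<bar> < \<bar>f s\<bar> \<or> \<bar>f s\<bar> = \<bar>f t\<bar> \<and> s < t" by auto
      have t: "s0 \<le> \<bar>f t\<bar>" using that T(2) by (auto simp: S_def)
      show "s \<in> S"
      proof (cases "s0 < \<bar>f s\<bar>")
        case True
        with s show ?thesis by (simp add: S_def)
      next
        case False
        with s t have "\<bar>f t\<bar> = s0" "\<bar>f s\<bar> = s0" "s < t" by linarith+
        with T(4)[of t s] that s show ?thesis by (simp add: S_def)
      qed
    qed
    show "t \<in> S" if t: "t \<in> I" "decr_rank I f t < ennreal x" for t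
    proof (rule ccontr)
      assume nS: "t \<notin> S"
      \<comment> \<open>A point outside an initial segment is preceded by the whole segment.\<close>
      have "ennreal x \<le> decr_rank I f t"
        unfolding decr_rank_def mS[symmetric]
      proof (rule emeasure_mono)
        show "S \<subseteq> {s \<in> I. \<bar>f t\<bar> < \<bar>f s\<bar> \<or> \<bar>f s\<bar> = \<bar>f t\<bar> \<and> s < t}"
        proof
          fix s assume "s \<in> S"
          then have "s \<in> I" "s0 \<le> \<bar>f s\<bar>" "s \<noteq> t" using T(2) nS by (auto simp: S_def)
          moreover have "\<bar>f t\<bar> \<le> s0" using nS t by (auto simp: S_def)
          moreover have "s < t" if "\<bar>f s\<bar> = \<bar>f t\<bar>"
          proof (rule ccontr)
            assume "\<not> s < t"
            then have "t < s" using \<open>s \<noteq> t\<close> by simp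
            moreover have "\<bar>f t\<bar> = s0" using that \<open>s0 \<le> \<bar>f s\<bar>\<close> \<open>\<bar>f t\<bar> \<le> s0\<close> by simp
            ultimately have "t \<in> T"
              using T(4)[of s t] \<open>s \<in> S\<close> that t by (auto simp: S_def)
            then show False using nS by (simp add: S_def)
          qed
          ultimately show "s \<in> {s \<in> I. \<bar>f t\<bar> < \<bar>f s\<bar> \<or> \<bar>f s\<bar> = \<bar>f t\<bar> \<and> s < t}"
            by (cases "\<bar>f s\<bar> = \<bar>f t\<bar>") simp_all
        qed
        show "{s \<in> I. \<bar>f t\<bar> < \<bar>f s\<bar> \<or> \<bar>f s\<bar> = \<bar>f t\<bar> \<and> s < t} \<in> sets lebesgue"
          by (intro sets_pred) measurable
      qed
      with t show False by simp
    qed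
  qed
qed

lemma rank_le: "decr_rank I f t \<le> emeasure lebesgue I"
  unfolding decr_rank_def by (rule emeasure_mono) auto

text \<open>The set lies inside a segment of measure \<open>x\<close> and contains segments of
  measures that increase to \<open>x\<close>. Completeness of Lebesgue measure then yields its
  measurability together with its measure; measurability of the rank is a consequence.\<close>

lemma rank_less:
  assumes "0 < x" "ennreal x \<le> emeasure lebesgue I"
  shows "{t \<in> I. decr_rank I f t < ennreal x} \<in> sets lebesgue" (is "?D \<in> _")
    and "emeasure lebesgue {t \<in> I. decr_rank I f t < ennreal x} = ennreal x"
proof -
  obtain S where S: "S \<in> sets lebesgue" "emeasure lebesgue S = ennreal x" "?D \<subseteq> S"
    by (rule initial_segment[OF assms]) blast
  have "\<exists>R. R \<in> sets lebesgue \<and> emeasure lebesgue R = ennreal y \<and> R \<subseteq> ?D"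
    if "0 < y" "y < x" for y
  proof -
    have y: "ennreal y < ennreal x" using that by (simp add: ennreal_lessI)
    then have "ennreal y \<le> emeasure lebesgue I" using assms(2) by simp
    then show ?thesis
    proof (rule initial_segment[OF that(1)])
      fix R assume R: "R \<in> sets lebesgue" "R \<subseteq> I" "emeasure lebesgue R = ennreal y"
        "\<And>t. t \<in> R \<Longrightarrow> decr_rank I f t \<le> ennreal y"
      have "R \<subseteq> ?D" using R(2) le_less_trans[OF R(4) y] by blast
      with R show ?thesis by blast
    qed
  qed
  then have "\<forall>y. \<exists>R. 0 < y \<and> y < x \<longrightarrow>
      R \<in> sets lebesgue \<and> emeasure lebesgue R = ennreal y \<and> R \<subseteq> ?D" by blast
  then obtain R where R: "\<And>y. 0 < y \<Longrightarrow> y < x \<Longrightarrow>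
      R y \<in> sets lebesgue \<and> emeasure lebesgue (R y) = ennreal y \<and> R y \<subseteq> ?D"
    unfolding choice_iff by blast
  obtain u where u: "\<And>n. 0 < u n" "\<And>n. u n < x" "u \<longlonglongrightarrow> x"
    using incseq_approx_below[OF assms(1)] by metis
  define U where "U = (\<Union>n. R (u n))"
  have U: "U \<in> sets lebesgue" "U \<subseteq> ?D"
    unfolding U_def using R[OF u(1,2)] by blast+
  have "ennreal x \<le> emeasure lebesgue U"
  proof (rule LIMSEQ_le_const2)
    show "(\<lambda>n. ennreal (u n)) \<longlonglongrightarrow> ennreal x" by (intro tendsto_ennrealI u)
    have "ennreal (u n) \<le> emeasure lebesgue U" for n
      using R[OF u(1,2), of n] emeasure_mono[of "R (u n)" U lebesgue] U(1)
      by (auto simp: U_def)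
    then show "\<exists>N. \<forall>n\<ge>N. ennreal (u n) \<le> emeasure lebesgue U" by blast
  qed
  moreover have "emeasure lebesgue U \<le> emeasure lebesgue S"
    using S U by (intro emeasure_mono) auto
  ultimately have eq: "emeasure lebesgue U = emeasure lebesgue S" using S(2) by simp
  show D: "?D \<in> sets lebesgue"
    by (rule completion.complete_sets_sandwich[OF U(1) S(1) U(2) S(3) eq]) (simp add: eq S(2))
  show "emeasure lebesgue ?D = ennreal x"
    using emeasure_mono[OF U(2) D] emeasure_mono[OF S(3) S(1)] eq S(2) by simp
qed

lemma rank_less_nonneg:
  assumes "0 \<le> x"
  shows "{t \<in> I. decr_rank I f t < ennreal x} \<in> sets lebesgue"
    and "ennreal x \<le> emeasure lebesgue I \<Longrightarrow> emeasure lebesgue {t \<in> I. decr_rank I f t < ennreal x} = ennreal x"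
proof -
  show "{t \<in> I. decr_rank I f t < ennreal x} \<in> sets lebesgue"
  proof (cases "ennreal x \<le> emeasure lebesgue I")
    case True
    then show ?thesis using rank_less(1)[of x] assms by (cases "x = 0") auto
  next
    case False
    then have "{t \<in> I. decr_rank I f t < ennreal x} = I"
      using le_less_trans[OF rank_le] not_le by blast
    then show ?thesis by simp
  qed
  show "emeasure lebesgue {t \<in> I. decr_rank I f t < ennreal x} = ennreal x" if "ennreal x \<le> emeasure lebesgue I"
    using rank_less(2)[of x] assms that by (cases "x = 0") auto
qed

lemma borel_measurable_rank [measurable]: "decr_rank I f \<in> borel_measurable (lebesgue_on I)"
proof (rule borel_measurableI_less)
  fix c :: ennreal
  have "{t \<in> I. decr_rank I f t < c} \<in> sets lebesgue"
  proof (cases c)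
    case (real x)
    then show ?thesis using rank_less_nonneg(1)[of x] by simp
  next
    case top
    have "\<exists>n. r < ennreal (real n)" if "r < top" for r
      using that by (metis ennreal_Ex_less_of_nat ennreal_of_nat_eq_real_of_nat infinity_ennreal_def)
    then have "{t \<in> I. decr_rank I f t < c} = (\<Union>n. {t \<in> I. decr_rank I f t < ennreal (real n)})"
      using top by (auto intro: less_trans)
    then show ?thesis using rank_less_nonneg(1) by auto
  qed
  then show "{t \<in> space (lebesgue_on I). decr_rank I f t < c} \<in> sets (lebesgue_on I)"
    by (simp add: sets_restrict_space_iff)
qed

lemma rank_eq_0_null: "{t \<in> I. decr_rank I f t = 0} \<in> null_sets lebesgue"
proof -
  have le: "emeasure lebesgue {t \<in> I. decr_rank I f t = 0} \<le> ennreal x" if "0 < x" for x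
  proof (cases "ennreal x \<le> emeasure lebesgue I")
    case True
    have "emeasure lebesgue {t \<in> I. decr_rank I f t = 0} \<le> emeasure lebesgue {t \<in> I. decr_rank I f t < ennreal x}"
      using that rank_less_nonneg(1)[of x] by (intro emeasure_mono) auto
    then show ?thesis using rank_less(2)[OF that True] by simp
  next
    case False
    have "emeasure lebesgue {t \<in> I. decr_rank I f t = 0} \<le> emeasure lebesgue I"
      by (intro emeasure_mono) auto
    then show ?thesis using False by simp
  qed
  have "emeasure lebesgue {t \<in> I. decr_rank I f t = 0} \<le> 0"
    by (rule ennreal_le_epsilon) (simp only: add_0 le)
  moreover have "{t \<in> I. decr_rank I f t = 0} \<in> sets lebesgue"
    by (intro sets_pred) measurable
  ultimately show ?thesis
    by (intro null_setsI) (simp_all only: le_zero_eq)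
qed

end

section \<open>Measure preserving maps between two sets\<close>

definition measure_preserving_between :: "real set \<Rightarrow> real set \<Rightarrow> (real \<Rightarrow> real) \<Rightarrow> bool" where
  "measure_preserving_between E I \<rho> \<longleftrightarrow> \<rho> \<in> E \<rightarrow> I \<and>
     (\<forall>A. A \<subseteq> I \<and> A \<in> sets lebesgue \<longrightarrow>
        \<rho> -` A \<inter> E \<in> sets lebesgue \<and> emeasure lebesgue (\<rho> -` A \<inter> E) = emeasure lebesgue A)"

lemma measure_preserving_on_iff_between:
  "measure_preserving_on I \<rho> \<longleftrightarrow> measure_preserving_between I I \<rho>"
  by (simp add: measure_preserving_on_def measure_preserving_between_def)

lemma measure_preserving_betweenD:
  assumes "measure_preserving_between E I \<rho>" "A \<subseteq> I" "A \<in> sets lebesgue"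
  shows "\<rho> -` A \<inter> E \<in> sets lebesgue" "emeasure lebesgue (\<rho> -` A \<inter> E) = emeasure lebesgue A"
  using assms unfolding measure_preserving_between_def by blast+

lemma measurable_measure_preserving_between:
  assumes "measure_preserving_between E I \<rho>" "E \<in> sets lebesgue" "I \<in> sets lebesgue"
  shows "\<rho> \<in> lebesgue_on E \<rightarrow>\<^sub>M lebesgue_on I"
proof (rule measurableI)
  show "\<rho> t \<in> space (lebesgue_on I)" if "t \<in> space (lebesgue_on E)" for t
    using assms(1) that by (auto simp: measure_preserving_between_def)
  fix A assume "A \<in> sets (lebesgue_on I)"
  then have "A \<subseteq> I" "A \<in> sets lebesgue" using assms(3) by (auto simp: sets_restrict_space_iff)
  then show "\<rho> -` A \<inter> space (lebesgue_on E) \<in> sets (lebesgue_on E)"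
    using measure_preserving_betweenD(1)[OF assms(1)] assms(2) by (simp add: sets_restrict_space_iff)
qed

lemma nn_integral_measure_preserving_between:
  assumes \<rho>: "measure_preserving_between E I \<rho>" "E \<in> sets lebesgue" "I \<in> sets lebesgue"
    and h: "h \<in> borel_measurable (lebesgue_on I)"
  shows "(\<integral>\<^sup>+ t. h (\<rho> t) \<partial>lebesgue_on E) = (\<integral>\<^sup>+ t. h t \<partial>lebesgue_on I)"
proof -
  have "distr (lebesgue_on E) (lebesgue_on I) \<rho> = lebesgue_on I"
  proof (rule measure_eqI)
    fix A assume A: "A \<in> sets (distr (lebesgue_on E) (lebesgue_on I) \<rho>)"
    then have "A \<subseteq> I" "A \<in> sets lebesgue" using \<rho>(3) by (auto simp: sets_restrict_space_iff)
    have "emeasure (distr (lebesgue_on E) (lebesgue_on I) \<rho>) A =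
        emeasure (lebesgue_on E) (\<rho> -` A \<inter> space (lebesgue_on E))"
      using A by (intro emeasure_distr measurable_measure_preserving_between[OF \<rho>]) simp
    also have "\<dots> = emeasure lebesgue (\<rho> -` A \<inter> E)"
      unfolding space_lebesgue_on using \<rho>(2) by (intro emeasure_restrict_space) auto
    also have "\<dots> = emeasure lebesgue A"
      by (rule measure_preserving_betweenD(2)[OF \<rho>(1)]) fact+
    also have "\<dots> = emeasure (lebesgue_on I) A"
      using \<open>A \<subseteq> I\<close> \<rho>(3) by (intro emeasure_restrict_space[symmetric]) auto
    finally show "emeasure (distr (lebesgue_on E) (lebesgue_on I) \<rho>) A = emeasure (lebesgue_on I) A" .
  qed simp
  then show ?thesis
    using nn_integral_distr[OF measurable_measure_preserving_between[OF \<rho>], of h] h by simp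
qed

text \<open>Half-lines are stable under intersection and generate the Borel sets, and
  \<open>fin\<close> gives an exhaustion by sets of finite measure; so equality on them determines
  the push-forward. Completion extends it to Lebesgue sets.\<close>

lemma measure_preserving_betweenI:
  assumes E: "E \<in> sets lebesgue" and I: "I \<in> sets borel" and \<rho>: "\<rho> \<in> E \<rightarrow> I"
    and [measurable]: "\<rho> \<in> borel_measurable (lebesgue_on E)"
    and eq: "\<And>x. emeasure lebesgue {t \<in> E. \<rho> t < x} = emeasure lebesgue (I \<inter> {..<x})"
    and fin: "\<And>x. emeasure lebesgue (I \<inter> {..<x}) < \<infinity>"
  shows "measure_preserving_between E I \<rho>"
proof -
  let ?M = "distr (lebesgue_on E) borel \<rho>" and ?N = "distr (lebesgue_on I) borel (\<lambda>t. t)"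
  have I': "I \<in> sets lebesgue" using I by simp
  have id: "(\<lambda>t. t) \<in> borel_measurable (lebesgue_on I)"
    by (simp add: measurable_completion measurable_restrict_space1)
  have M: "emeasure ?M B = emeasure lebesgue (\<rho> -` B \<inter> E)" "\<rho> -` B \<inter> E \<in> sets lebesgue"
    and N: "emeasure ?N B = emeasure lebesgue (I \<inter> B)" if "B \<in> sets borel" for B
  proof -
    have "\<rho> -` B \<inter> space (lebesgue_on E) \<in> sets (lebesgue_on E)"
      using that by (rule measurable_sets[rotated]) measurable
    then show "\<rho> -` B \<inter> E \<in> sets lebesgue" using E by (simp add: sets_restrict_space_iff)
    show "emeasure ?M B = emeasure lebesgue (\<rho> -` B \<inter> E)"
      using that E by (simp add: emeasure_distr emeasure_restrict_space)
    show "emeasure ?N B = emeasure lebesgue (I \<inter> B)"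
      using that I' by (simp add: emeasure_distr[OF id] emeasure_restrict_space Int_commute)
  qed
  have "?M = ?N"
  proof (rule measure_eqI_generator_eq)
    show "Int_stable (range (lessThan :: real \<Rightarrow> real set))"
    proof (rule Int_stableI)
      have "{..<x} \<inter> {..<y} = {..<min x y}" for x y :: real by auto
      then show "A \<inter> B \<in> range lessThan" if "A \<in> range lessThan" "B \<in> range lessThan"
        for A B :: "real set"
        using that by auto
    qed
    show "range (lessThan :: real \<Rightarrow> real set) \<subseteq> Pow UNIV" by simp
    show "emeasure ?M X = emeasure ?N X" if "X \<in> range lessThan" for X
    proof -
      from that obtain x where X: "X = {..<x}" by blast
      have "\<rho> -` X \<inter> E = {t \<in> E. \<rho> t < x}" by (auto simp: X)
      then show ?thesis using eq[of x] by (simp add: M(1) N X)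
    qed
    show "sets ?M = sigma_sets UNIV (range lessThan)" "sets ?N = sigma_sets UNIV (range lessThan)"
      by (simp_all add: borel_Iio)
    show "range (\<lambda>n. {..<real n}) \<subseteq> range lessThan" by auto
    show "(\<Union>n. {..<real n}) = UNIV" using reals_Archimedean2 by auto
    show "emeasure ?M {..<real n} \<noteq> \<infinity>" for n
    proof -
      have "\<rho> -` {..<real n} \<inter> E = {t \<in> E. \<rho> t < real n}" by auto
      then show ?thesis using eq[of "real n"] fin[of "real n"] by (simp add: M(1))
    qed
  qed
  then have borel: "emeasure lebesgue (\<rho> -` B \<inter> E) = emeasure lebesgue (I \<inter> B)" if "B \<in> sets borel" for B
    using M(1)[OF that] N[OF that] by simp
  show ?thesis
    unfolding measure_preserving_between_def
  proof (intro conjI allI impI \<rho>; elim conjE)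
    fix A assume A: "A \<subseteq> I" "A \<in> sets lebesgue"
    \<comment> \<open>\<open>A\<close> is a Borel set up to a part of a Borel null set, and the
      preimage of that null set is already known to be null.\<close>
    from A(2) obtain S Z Z' where SZ: "A = S \<union> Z" "Z \<subseteq> Z'" "Z' \<in> null_sets lborel" "S \<in> sets lborel"
      by (rule sets_completionE)
    have Z': "Z' \<in> sets borel" "emeasure lborel Z' = 0" using SZ(3) by (auto simp: null_sets_def)
    have "Z' \<in> null_sets lebesgue" using SZ(3) by (simp add: null_sets_completionI)
    then have Znull: "Z \<in> null_sets lebesgue" "I \<inter> Z' \<in> null_sets lebesgue"
      using SZ(2) I' by (auto intro: null_sets_completion_subset null_set_Int1 simp: Int_commute)
    have "\<rho> -` Z' \<inter> E \<in> null_sets lebesgue"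
      using borel[OF Z'(1)] M(2)[OF Z'(1)] Znull(2) by (intro null_setsI) auto
    then have pre: "\<rho> -` Z \<inter> E \<in> null_sets lebesgue"
      by (rule null_sets_completion_subset[rotated]) (use SZ(2) in auto)
    have S: "S \<in> sets borel" "S \<in> sets lebesgue" using SZ(4) by auto
    have split: "\<rho> -` A \<inter> E = (\<rho> -` S \<inter> E) \<union> (\<rho> -` Z \<inter> E)" using SZ(1) by auto
    show "\<rho> -` A \<inter> E \<in> sets lebesgue"
      unfolding split using M(2)[OF S(1)] pre by (intro sets.Un) auto
    have "emeasure lebesgue (\<rho> -` A \<inter> E) = emeasure lebesgue (\<rho> -` S \<inter> E)"
      unfolding split using M(2)[OF S(1)] pre by (rule emeasure_Un_null_set)
    also have "\<dots> = emeasure lebesgue (I \<inter> S)" by (rule borel[OF S(1)])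
    also have "I \<inter> S = S" using A(1) SZ(1) by auto
    also have "emeasure lebesgue S = emeasure lebesgue A"
      unfolding SZ(1) using S(2) Znull(1) by (rule emeasure_Un_null_set[symmetric])
    finally show "emeasure lebesgue (\<rho> -` A \<inter> E) = emeasure lebesgue A" .
  qed
qed

lemma AE_lebesgue_on_null_setI:
  assumes "I \<in> sets lebesgue" "N \<in> null_sets lebesgue" "\<And>t. t \<in> I \<Longrightarrow> t \<notin> N \<Longrightarrow> P t"
  shows "AE t in lebesgue_on I. P t"
proof -
  have "AE t in lebesgue. t \<notin> N" using assms(2) by (rule AE_not_in)
  then have "AE t in lebesgue. t \<in> I \<longrightarrow> P t" by eventually_elim (use assms(3) in auto)
  then show ?thesis using assms(1) by (simp add: AE_restrict_space_iff)
qed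

section \<open>The rank as a measure preserving map\<close>

context vanishing_at_infinity
begin

text \<open>The points whose rank falls into the open interval \<open>I\<close>. For infinite
  \<open>a\<close> this excludes the points of infinite rank.\<close>

definition ranked :: "real set" where
  "ranked = {t \<in> I. 0 < decr_rank I f t \<and> decr_rank I f t < emeasure lebesgue I}"

definition rank_map :: "real \<Rightarrow> real" where
  "rank_map t = enn2real (decr_rank I f t)"

lemma ranked_sets [measurable, simp]: "ranked \<in> sets lebesgue"
  unfolding ranked_def by (intro sets_pred) measurable

lemma lebesgue_on_ranked: "lebesgue_on ranked = restrict_space (lebesgue_on I) ranked"
proof -
  have "I \<inter> ranked = ranked" by (auto simp: ranked_def)
  then show ?thesis by (simp add: restrict_restrict_space)
qed

lemma rank_eq_rank_map:
  assumes "t \<in> ranked"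
  shows "decr_rank I f t = ennreal (rank_map t)"
proof -
  have "decr_rank I f t < emeasure lebesgue I" using assms unfolding ranked_def by blast
  then have "decr_rank I f t < top" by (rule less_le_trans) (rule top_greatest)
  then show ?thesis by (simp add: rank_map_def)
qed

lemma emeasure_I: "emeasure lebesgue I = e2ennreal a"
  unfolding I_eq by (rule emeasure_einterval_0[OF less_imp_le[OF a]])

lemma rank_map_in_I:
  assumes "t \<in> ranked"
  shows "rank_map t \<in> I"
proof -
  have "0 < ennreal (rank_map t)" "ennreal (rank_map t) < e2ennreal a"
    using assms rank_eq_rank_map[OF assms] by (auto simp: ranked_def emeasure_I)
  then show ?thesis
    using a by (cases a) (auto simp: I_eq einterval_iff e2ennreal_ereal ennreal_less_iff)
qed

lemma rank_less_ranked:
  assumes "0 \<le> x" "ennreal x \<le> emeasure lebesgue I"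
  shows "emeasure lebesgue {t \<in> ranked. decr_rank I f t < ennreal x} = ennreal x"
proof -
  have "{t \<in> ranked. decr_rank I f t < ennreal x} = {t \<in> I. decr_rank I f t < ennreal x} - {t \<in> I. decr_rank I f t = 0}"
    using assms(2) by (auto simp: ranked_def zero_less_iff_neq_zero intro: less_le_trans)
  then show ?thesis
    using rank_less_nonneg[OF assms(1)] assms(2) rank_eq_0_null by (simp add: emeasure_Diff_null_set)
qed

lemma emeasure_I_Int_lessThan:
  "emeasure lebesgue (I \<inter> {..<x}) = min (ennreal x) (emeasure lebesgue I)"
proof (cases "0 < x")
  case True
  have "I \<inter> {..<x} = einterval 0 (min a (ereal x))" by (auto simp: I_eq einterval_iff)
  moreover have "e2ennreal (min a (ereal x)) = min (ennreal x) (e2ennreal a)"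
    using True a by (cases a) (auto simp: e2ennreal_ereal min_def)
  ultimately show ?thesis
    using True a emeasure_einterval_0[of "min a (ereal x)"] by (simp add: emeasure_I)
next
  case False
  then have "I \<inter> {..<x} = {}" using I_pos by force
  then show ?thesis using False by (simp add: ennreal_neg)
qed

lemma measure_preserving_rank_map: "measure_preserving_between ranked I rank_map"
proof (rule measure_preserving_betweenI)
  show "I \<in> sets borel" by (simp add: I_eq)
  show "rank_map \<in> ranked \<rightarrow> I" using rank_map_in_I by blast
  have "decr_rank I f \<in> borel_measurable (lebesgue_on ranked)"
    by (simp add: lebesgue_on_ranked measurable_restrict_space1)
  then show "rank_map \<in> borel_measurable (lebesgue_on ranked)"
    unfolding rank_map_def[abs_def] by (rule measurable_compose) simp
  show "emeasure lebesgue (I \<inter> {..<x}) < \<infinity>" for x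
    by (simp add: emeasure_I_Int_lessThan min_less_iff_disj)
  show "emeasure lebesgue {t \<in> ranked. rank_map t < x} = emeasure lebesgue (I \<inter> {..<x})" for x
  proof -
    \<comment> \<open>Ranks in \<open>ranked\<close> are below the measure of \<open>I\<close>, so
      truncating \<open>x\<close> there, and at 0, changes no comparison.\<close>
    define y where "y = enn2real (min (ennreal x) (emeasure lebesgue I))"
    have y: "ennreal y = min (ennreal x) (emeasure lebesgue I)" "0 \<le> y"
      by (auto simp: y_def min_less_iff_disj)
    have "rank_map t < x \<longleftrightarrow> decr_rank I f t < ennreal y" if "t \<in> ranked" for t
    proof -
      have "0 < rank_map t" using rank_map_in_I[OF that] by (rule I_pos)
      then have "rank_map t < x \<longleftrightarrow> decr_rank I f t < ennreal x"
        using rank_eq_rank_map[OF that] by (simp add: ennreal_less_iff)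
      also have "\<dots> \<longleftrightarrow> decr_rank I f t < ennreal y"
        using that by (auto simp: y(1) ranked_def)
      finally show ?thesis .
    qed
    then have "{t \<in> ranked. rank_map t < x} = {t \<in> ranked. decr_rank I f t < ennreal y}" by blast
    then show ?thesis
      using rank_less_ranked[OF y(2)] y(1) by (simp add: emeasure_I_Int_lessThan)
  qed
qed simp

text \<open>All points with a larger value of \<open>\<bar>f\<bar>\<close> precede \<open>t\<close>,
  so its rank is at least the distribution function at \<open>\<bar>f t\<bar>\<close>.\<close>

lemma rearrangement_rank_map_le:
  assumes "t \<in> ranked"
  shows "rearrangement I f (rank_map t) \<le> ennreal \<bar>f t\<bar>"
proof -
  have "distribution_fun I f \<bar>f t\<bar> \<le> decr_rank I f t"
    unfolding distribution_fun_def decr_rank_def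
  proof (rule emeasure_mono)
    show "{s \<in> I. \<bar>f t\<bar> < \<bar>f s\<bar> \<or> \<bar>f s\<bar> = \<bar>f t\<bar> \<and> s < t} \<in> sets lebesgue"
      by (intro sets_pred) measurable
  qed auto
  then show ?thesis
    using less_rearrangement_iff[OF I f, of "\<bar>f t\<bar>" "rank_map t"] rank_eq_rank_map[OF assms]
    by (simp add: not_less[symmetric])
qed

text \<open>One inequality holds at every ranked point. By it, the subtracted set in
  \<open>N q\<close> lies in the superlevel set at \<open>q\<close>; both have the same finite
  measure, so \<open>N q\<close> is null. Where the other inequality fails, a positive rational
  \<open>q\<close> separates the two values and the point lies in \<open>N q\<close>.\<close>

lemma AE_rearrangement_rank_map:
  "AE t in lebesgue_on I. t \<in> ranked \<longrightarrow> ennreal \<bar>f t\<bar> = rearrangement I f (rank_map t)"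
proof -
  define N where "N q = {t \<in> I. q < \<bar>f t\<bar>} - {t \<in> ranked. decr_rank I f t < distribution_fun I f q}" for q
  have "N q \<in> null_sets lebesgue" if "0 < q" for q
  proof -
    define x where "x = enn2real (distribution_fun I f q)"
    have x: "distribution_fun I f q = ennreal x" "0 \<le> x"
      using fin[OF that] by (auto simp: x_def)
    then have "ennreal x \<le> emeasure lebesgue I" by (metis distribution_fun_le_emeasure[OF I])
    then have m: "emeasure lebesgue {t \<in> ranked. decr_rank I f t < ennreal x} = ennreal x"
      by (rule rank_less_ranked[OF x(2)])
    have sub: "{t \<in> ranked. decr_rank I f t < ennreal x} \<subseteq> {t \<in> I. q < \<bar>f t\<bar>}"
    proof
      fix t assume t: "t \<in> {t \<in> ranked. decr_rank I f t < ennreal x}"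
      then have "ennreal q < rearrangement I f (rank_map t)"
        using less_rearrangement_iff[OF I f, of q "rank_map t"] \<open>0 < q\<close> x(1) rank_eq_rank_map[of t]
        by simp
      also have "\<dots> \<le> ennreal \<bar>f t\<bar>" using t by (intro rearrangement_rank_map_le) simp
      finally show "t \<in> {t \<in> I. q < \<bar>f t\<bar>}"
        using t \<open>0 < q\<close> by (simp add: ennreal_less_iff ranked_def)
    qed
    have "{t \<in> ranked. decr_rank I f t < ennreal x} = ranked \<inter> {t \<in> I. decr_rank I f t < ennreal x}"
      by (auto simp: ranked_def)
    then have sets: "{t \<in> ranked. decr_rank I f t < ennreal x} \<in> sets lebesgue"
      using rank_less_nonneg(1)[OF x(2)] by simp
    have "emeasure lebesgue (N q) = 0"
      unfolding N_def x(1) using x m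
      by (subst emeasure_Diff[OF _ L0_sets_greater[OF I f] sets sub]) (auto simp: distribution_fun_def)
    then show ?thesis
      using sets L0_sets_greater[OF I f, of q] by (intro null_setsI) (auto simp: N_def x(1))
  qed
  then have "(\<Union>q \<in> \<rat> \<inter> {0<..}. N q) \<in> null_sets lebesgue"
    by (intro null_sets_UN' countable_Int1 countable_rat) auto
  then show ?thesis
  proof (rule AE_lebesgue_on_null_setI[OF I], intro impI)
    fix t assume t: "t \<notin> (\<Union>q \<in> \<rat> \<inter> {0<..}. N q)" "t \<in> ranked" "t \<in> I"
    have "ennreal \<bar>f t\<bar> \<le> rearrangement I f (rank_map t)"
    proof (rule ccontr)
      assume "\<not> ?thesis"
      then obtain q where q: "q \<in> \<rat>" "rearrangement I f (rank_map t) < ennreal q" "ennreal q < ennreal \<bar>f t\<bar>"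
        using ennreal_rat_dense by (metis Rats_of_rat not_le)
      then have "0 < q" by (metis ennreal_neg not_less not_less_zero)
      with q t have "t \<notin> N q" "q < \<bar>f t\<bar>" by (auto simp: ennreal_less_iff)
      then have "decr_rank I f t < distribution_fun I f q" using t by (auto simp: N_def)
      then show False
        using less_rearrangement_iff[OF I f, of q "rank_map t"] \<open>0 < q\<close> q(2) rank_eq_rank_map[OF t(2)]
        by auto
    qed
    then show "ennreal \<bar>f t\<bar> = rearrangement I f (rank_map t)"
      using rearrangement_rank_map_le[OF t(2)] by (rule antisym)
  qed
qed

text \<open>\<open>ranked\<close> is the preimage of all of \<open>I\<close>, so it has the measure
  of \<open>I\<close>; finiteness of that measure makes the complement null.\<close>

lemma AE_ranked:
  assumes "a < \<infinity>"
  shows "AE t in lebesgue_on I. t \<in> ranked"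
proof -
  have "emeasure lebesgue I \<noteq> \<infinity>" using assms a by (cases a) (auto simp: emeasure_I e2ennreal_ereal)
  moreover have "emeasure lebesgue ranked = emeasure lebesgue I"
  proof -
    have "rank_map -` I \<inter> ranked = ranked" using rank_map_in_I by auto
    then show ?thesis
      using measure_preserving_rank_map I by (metis measure_preserving_between_def subset_refl)
  qed
  moreover have "ranked \<subseteq> I" by (auto simp: ranked_def)
  ultimately have "I - ranked \<in> null_sets lebesgue"
    by (intro null_setsI) (auto simp: emeasure_Diff)
  then show ?thesis by (rule AE_lebesgue_on_null_setI[OF I]) auto
qed

lemma AE_unranked_eq_0:
  assumes "a = \<infinity>"
  shows "AE t in lebesgue_on I. t \<notin> ranked \<longrightarrow> f t = 0"
  using rank_eq_0_null
proof (rule AE_lebesgue_on_null_setI[OF I], intro impI)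
  fix t assume t: "t \<in> I" "t \<notin> {t \<in> I. decr_rank I f t = 0}" "t \<notin> ranked"
  show "f t = 0"
  proof (rule ccontr)
    assume "f t \<noteq> 0"
    \<comment> \<open>The rank also counts ties, so a level strictly below
      \<open>\<bar>f t\<bar>\<close> is needed.\<close>
    have "decr_rank I f t \<le> distribution_fun I f (\<bar>f t\<bar> / 2)"
      unfolding decr_rank_def distribution_fun_def using \<open>f t \<noteq> 0\<close>
      by (intro emeasure_mono L0_sets_greater[OF I f]) auto
    also have "\<dots> < \<infinity>" using \<open>f t \<noteq> 0\<close> by (intro fin) simp
    finally show False
      using t assms by (auto simp: ranked_def emeasure_I zero_less_iff_neq_zero)
  qed
qed

end

section \<open>Attainment of the infima\<close>

text \<open>A null dense \<open>G\<^sub>\<delta>\<close> set is completely metrizable and has no isolated points, so it has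
  the cardinality of the continuum. Redefining a measure preserving map on it makes the map onto.\<close>

lemma ex_null_set_onto:
  assumes a: "0 < (a :: ereal)"
  obtains K k where "K \<in> null_sets lebesgue" "K \<subseteq> einterval 0 a" "k ` K = einterval 0 a"
proof -
  let ?I = "einterval 0 a"
  have "\<rat> \<in> null_sets (lborel :: real measure)"
    by (rule countable_imp_null_set_lborel) (rule countable_rat)
  then have Q: "(\<rat> :: real set) \<in> sets borel" "emeasure lborel (\<rat> :: real set) = 0"
    by (auto simp: null_sets_def)
  have "\<forall>n. \<exists>U. open U \<and> (\<rat> :: real set) \<subseteq> U \<and> emeasure lborel U < ennreal (1 / real (Suc n))"
  proof
    fix n :: nat
    obtain U where U: "open U" "(\<rat> :: real set) \<subseteq> U" "emeasure lborel (U - \<rat>) < ennreal (1 / real (Suc n))"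
      by (rule outer_regular_lborel[OF Q(1), of "1 / real (Suc n)"]) auto
    have "emeasure lborel U \<le> emeasure lborel (U - \<rat>) + emeasure lborel (\<rat> :: real set)"
      using U(1,2) Q(1) emeasure_subadditive[of "U - \<rat>" lborel \<rat>] by (simp add: Un_absorb2)
    also have "\<dots> < ennreal (1 / real (Suc n))" using U(3) Q(2) by (simp del: of_nat_Suc)
    finally show "\<exists>U. open U \<and> (\<rat> :: real set) \<subseteq> U \<and> emeasure lborel U < ennreal (1 / real (Suc n))"
      using U(1,2) by blast
  qed
  then obtain U :: "nat \<Rightarrow> real set" where U: "\<And>n. open (U n)" "\<And>n. \<rat> \<subseteq> U n"
      "\<And>n. emeasure lborel (U n) < ennreal (1 / real (Suc n))"
    unfolding choice_iff by blast
  \<comment> \<open>Each \<open>U n\<close> contains the rationals, so \<open>G\<close> is dense in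
    the interval; their measures tend to 0, so \<open>G\<close> is null.\<close>
  define G where "G = ?I \<inter> (\<Inter>n. U n)"
  have G: "G \<in> sets borel"
    unfolding G_def using U(1) by (intro sets.Int sets.countable_INT'') auto
  have "emeasure lborel G \<le> 0"
  proof (rule ennreal_le_epsilon)
    fix e :: real assume "0 < e"
    then obtain n where n: "1 / real (Suc n) < e" using nat_approx_posE by blast
    have "emeasure lborel G \<le> emeasure lborel (U n)"
      using U(1)[of n] by (intro emeasure_mono) (auto simp: G_def)
    also have "\<dots> \<le> ennreal e"
      using U(3)[of n] n by (meson ennreal_leI le_less_trans less_imp_le order_trans)
    finally show "emeasure lborel G \<le> 0 + ennreal e" by simp
  qed
  then have null: "G \<in> null_sets lebesgue"
    using G by (intro null_sets_completionI) (auto simp: null_sets_def)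
  let ?X = "subtopology euclidean G"
  have "completely_metrizable_space ?X"
  proof (rule completely_metrizable_space_gdelta_in_alt[OF completely_metrizable_space_euclidean])
    show "(countable intersection_of openin euclidean) G"
      unfolding intersection_of_def using U(1)
      by (intro exI[of _ "insert ?I (range U)"]) (auto simp: G_def)
  qed
  moreover have "?X derived_set_of G = G"
  proof (intro equalityI subsetI)
    fix x assume x: "x \<in> G"
    show "x \<in> ?X derived_set_of G"
      unfolding in_derived_set_of
    proof (intro conjI allI impI)
      fix T assume T: "x \<in> T \<and> openin ?X T"
      then obtain V where V: "open V" "T = G \<inter> V" by (auto simp: openin_open)
      have "open (V \<inter> ?I)" "x \<in> V \<inter> ?I" using V T x by (auto simp: G_def)
      then obtain e where e: "0 < e" "ball x e \<subseteq> V \<inter> ?I" using open_contains_ball by blast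
      obtain r where r: "r \<in> \<rat>" "x < r" "r < x + e" using Rats_dense_in_real[of x "x + e"] e by auto
      then have "r \<in> ball x e" by (simp add: dist_real_def)
      then have "r \<in> V" "r \<in> ?I" using e by auto
      moreover have "r \<in> U n" for n using U(2) r(1) by blast
      ultimately show "\<exists>y. y \<noteq> x \<and> y \<in> G \<and> y \<in> T"
        using r(2) V(2) by (intro exI[of _ r]) (auto simp: G_def)
    qed (use x in auto)
  qed (auto simp: in_derived_set_of)
  moreover have "G \<noteq> {}"
  proof -
    obtain c where c: "0 < c" "ereal c < a" using a ereal_dense2[of 0 a] by auto
    obtain r where r: "r \<in> \<rat>" "0 < r" "r < c" using Rats_dense_in_real[OF c(1)] by auto
    then have "r \<in> ?I" using c by (auto simp: einterval_iff intro: less_trans[of "ereal r" "ereal c"])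
    moreover have "r \<in> U n" for n using U(2) r(1) by blast
    ultimately have "r \<in> G" by (simp add: G_def)
    then show ?thesis by blast
  qed
  ultimately have "(UNIV :: real set) \<lesssim> G"
    by (intro lepoll_perfect_set[of ?X]) auto
  then have "\<exists>g :: real \<Rightarrow> real. inj g \<and> range g \<subseteq> G" by (simp add: lepoll_def)
  then obtain g :: "real \<Rightarrow> real" where g: "inj g" "range g \<subseteq> G" by blast
  show ?thesis
  proof
    \<comment> \<open>The injection \<open>g\<close> comes from cardinality alone and need not be
      measurable; completeness makes every subset of \<open>G\<close> null.\<close>
    show "g ` ?I \<in> null_sets lebesgue"
      by (rule null_sets_completion_subset[OF _ null]) (use g in auto)
    show "g ` ?I \<subseteq> ?I" using g(2) by (auto simp: G_def)
    show "inv g ` (g ` ?I) = ?I" using g(1) by (simp add: image_image)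
  qed
qed

text \<open>On \<open>N\<close> the map \<open>\<sigma>\<close> may be arbitrary: by completeness,
  whatever part of \<open>N\<close> a preimage contains is measurable and null.\<close>

lemma measure_preserving_on_eq_outside_null_set:
  assumes \<rho>: "measure_preserving_between E I \<rho>" and I: "I \<in> sets lebesgue" and E: "E \<subseteq> I"
    and N: "N \<in> null_sets lebesgue" "I - E \<subseteq> N"
    and \<sigma>: "\<sigma> \<in> I \<rightarrow> I" "\<And>t. t \<in> E \<Longrightarrow> t \<notin> N \<Longrightarrow> \<sigma> t = \<rho> t"
  shows "measure_preserving_on I \<sigma>"
  unfolding measure_preserving_on_def
proof (intro conjI allI impI \<sigma>(1); elim conjE)
  fix A assume A: "A \<subseteq> I" "A \<in> sets lebesgue"
  let ?B = "\<rho> -` A \<inter> E - N" and ?Z = "{t \<in> N. t \<in> I \<and> \<sigma> t \<in> A}"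
  have Z: "?Z \<in> null_sets lebesgue" by (rule null_sets_completion_subset[OF _ N(1)]) auto
  note preimage = measure_preserving_betweenD[OF \<rho> A]
  have B: "?B \<in> sets lebesgue" using preimage(1) N(1) by auto
  have "t \<in> \<sigma> -` A \<inter> I \<longleftrightarrow> t \<in> ?B \<union> ?Z" for t
    using \<sigma>(2)[of t] E N(2) by (cases "t \<in> N") auto
  then have eq: "\<sigma> -` A \<inter> I = ?B \<union> ?Z" by blast
  show "\<sigma> -` A \<inter> I \<in> sets lebesgue" unfolding eq using B null_setsD2[OF Z] by (rule sets.Un)
  have "emeasure lebesgue (\<sigma> -` A \<inter> I) = emeasure lebesgue ?B"
    unfolding eq by (rule emeasure_Un_null_set[OF B Z])
  also have "\<dots> = emeasure lebesgue (\<rho> -` A \<inter> E)"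
    by (rule emeasure_Diff_null_set[OF N(1) preimage(1)])
  finally show "emeasure lebesgue (\<sigma> -` A \<inter> I) = emeasure lebesgue A"
    using preimage(2) by simp
qed

lemma (in vanishing_at_infinity) ex_onto_measure_preserving:
  assumes "a < \<infinity>"
  obtains \<sigma> where "measure_preserving_on I \<sigma>" "\<sigma> ` I = I"
    "AE t in lebesgue_on I. ennreal \<bar>f t\<bar> = rearrangement I f (\<sigma> t)"
proof -
  obtain K k where K: "K \<in> null_sets lebesgue" "K \<subseteq> I" "k ` K = I"
    using ex_null_set_onto[OF a] unfolding I_eq by blast
  obtain c where c: "c \<in> I" using a einterval_nonempty unfolding I_eq by blast
  \<comment> \<open>\<open>k\<close> takes precedence over the rank map so that all of
    \<open>I\<close> is reached; \<open>c\<close> only keeps the remaining values in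
    \<open>I\<close>.\<close>
  define \<sigma> where "\<sigma> t = (if t \<in> K then k t else if t \<in> ranked then rank_map t else c)" for t
  have ranked: "ranked \<subseteq> I" by (auto simp: ranked_def)
  have Un: "I - ranked \<in> null_sets lebesgue"
    using AE_ranked[OF assms] I
    by (simp add: AE_restrict_space_iff) 
      (subst AE_iff_null_sets, auto simp: set_diff_eq)
  show ?thesis
  proof
    show "measure_preserving_on I \<sigma>"
    proof (rule measure_preserving_on_eq_outside_null_set[OF measure_preserving_rank_map I ranked])
      show "K \<union> (I - ranked) \<in> null_sets lebesgue" using K(1) Un by (rule null_sets.Un)
      show "\<sigma> \<in> I \<rightarrow> I" using K c rank_map_in_I by (auto simp: \<sigma>_def)
    qed (auto simp: \<sigma>_def)
    have "I \<subseteq> \<sigma> ` I"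
    proof
      fix y assume "y \<in> I"
      then obtain t where "t \<in> K" "y = k t" using K(3) by blast
      then show "y \<in> \<sigma> ` I" using K(2) by (intro image_eqI[of _ _ t]) (auto simp: \<sigma>_def)
    qed
    then show "\<sigma> ` I = I" using K c rank_map_in_I by (auto simp: \<sigma>_def)
    have "AE t in lebesgue_on I. t \<notin> K"
      by (rule AE_lebesgue_on_null_setI[OF I K(1)])
    then show "AE t in lebesgue_on I. ennreal \<bar>f t\<bar> = rearrangement I f (\<sigma> t)"
      using AE_ranked[OF assms] AE_rearrangement_rank_map by eventually_elim (simp add: \<sigma>_def)
  qed
qed

lemma measure_preserving_comp:
  fixes a :: ereal
  defines "I \<equiv> einterval 0 a"
  assumes a: "0 < a" and \<sigma>: "measure_preserving_on I \<sigma>" and w: "w \<in> L0 I"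
  shows "w \<circ> \<sigma> \<in> L0 I" and "equimeasurable I (w \<circ> \<sigma>) w"
proof -
  have I: "I \<in> sets lebesgue" by (simp add: I_def)
  have mp: "measure_preserving_between I I \<sigma>" using \<sigma> by (simp add: measure_preserving_on_iff_between)
  show wL0: "w \<circ> \<sigma> \<in> L0 I"
    using measurable_comp[OF measurable_measure_preserving_between[OF mp I I]] w by (simp add: L0_def)
  have "distribution_fun I (w \<circ> \<sigma>) s = distribution_fun I w s" for s
  proof -
    have eq: "\<sigma> -` {t \<in> I. s < \<bar>w t\<bar>} \<inter> I = {t \<in> I. s < \<bar>(w \<circ> \<sigma>) t\<bar>}"
      using mp by (auto simp: measure_preserving_between_def)
    show ?thesis
      unfolding distribution_fun_def eq[symmetric]
      by (rule measure_preserving_betweenD(2)[OF mp _ L0_sets_greater[OF I w]]) blast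
  qed
  then show "equimeasurable I (w \<circ> \<sigma>) w"
    using equimeasurable_einterval_iff[OF a, of "w \<circ> \<sigma>" w] wL0 w by (simp add: I_def)
qed

text \<open>For fixed \<open>s\<close>, the perspective \<open>\<phi> (s / y) * y\<close> decreases
  in \<open>y\<close>: the point \<open>s / W\<close> is the convex combination of 0 and
  \<open>s / y\<close> with weight \<open>y / W\<close> on the latter, and
  \<open>\<phi> 0 = 0\<close>.\<close>

lemma orlicz_term_ge_perspective:
  assumes \<phi>: "orlicz_function \<phi>" and s: "0 < s" "ennreal s \<le> x" and y: "0 \<le> y" "y \<le> W" and W: "0 < W"
  shows "ennreal (\<phi> (s / W) * W) \<le> orlicz_term \<phi> x y"
proof (cases "x = \<infinity> \<or> y = 0")
  case True
  then show ?thesis using s by (auto simp: orlicz_term_def)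
next
  case False
  then obtain r where r: "x = ennreal r" "0 \<le> r" by (cases x) auto
  with s have "s \<le> r" by simp
  have pos: "0 < y" using False y by simp
  have "\<phi> ((1 - y / W) *\<^sub>R 0 + (y / W) *\<^sub>R (s / y)) \<le> (1 - y / W) * \<phi> 0 + (y / W) * \<phi> (s / y)"
    using s y W pos by (intro convex_onD[OF orlicz_function_D(5)[OF \<phi>]]) auto
  then have "\<phi> (s / W) \<le> (y / W) * \<phi> (s / y)"
    using pos orlicz_function_D(1)[OF \<phi>] by simp
  then have "\<phi> (s / W) * W \<le> \<phi> (s / y) * y" using W by (simp add: field_simps)
  also have "\<dots> \<le> \<phi> (r / y) * y"
    using pos s \<open>s \<le> r\<close> orlicz_function_D(3)[OF \<phi>, of "s / y" "r / y"]
    by (intro mult_right_mono) (auto simp: divide_right_mono)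
  finally show ?thesis using False r by (simp add: orlicz_term_def ennreal_leI)
qed

text \<open>If the distribution function were infinite at some \<open>s > 0\<close>, then
  \<open>f\<^sup>*\<close> would be at least \<open>s\<close> everywhere. As \<open>w\<close> is at
  most \<open>w 1\<close> on \<open>{1..}\<close>, the integrand would stay above a positive
  constant there and the integral would diverge.\<close>

lemma vanishing_at_infinityI:
  assumes \<phi>: "orlicz_function \<phi>" and a: "0 < a" and I_eq: "I = einterval 0 a"
    and w: "weight_function I w" and f: "f \<in> L0 I"
    and fin: "a < \<infinity> \<or> orlicz_integral \<phi> I (rearrangement I f) w < \<infinity>"
  shows "vanishing_at_infinity a I f"
proof
  show "0 < a" "I = einterval 0 a" "f \<in> L0 I" by fact+
  have I: "I \<in> sets lebesgue" by (simp add: I_eq)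
  have eI: "emeasure lebesgue I = e2ennreal a"
    unfolding I_eq by (rule emeasure_einterval_0[OF less_imp_le[OF a]])
  fix s :: real assume s: "0 < s"
  show "distribution_fun I f s < \<infinity>"
  proof (cases "a < \<infinity>")
    case True
    then have "e2ennreal a < \<infinity>" using a by (cases a) (auto simp: e2ennreal_ereal)
    then show ?thesis
      using distribution_fun_le_emeasure[OF I, of f s] eI by (simp only: le_less_trans)
  next
    case False
    then have "a = \<infinity>" by simp
    then have I_Ioi: "I = {0<..}" by (auto simp: I_eq einterval_iff)
    show ?thesis
    proof (rule ccontr)
      assume "\<not> ?thesis"
      then have top: "distribution_fun I f s = \<infinity>" by (simp add: not_less top_unique)
      then have large: "ennreal s \<le> rearrangement I f t" for t
        using less_rearrangement_iff[OF I f, of s t] s by simp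
      \<comment> \<open>If \<open>w 1 = 0\<close>, then \<open>w\<close> vanishes on
        \<open>{1..}\<close> and the integrand is infinite there, so any positive constant
        serves.\<close>
      define c where "c = (if w 1 = 0 then 1 else \<phi> (s / w 1) * w 1)"
      have w1: "0 \<le> w 1" using w by (simp add: weight_function_def I_Ioi)
      have c: "0 < c" using w1 s orlicz_function_pos[OF \<phi>, of "s / w 1"] by (simp add: c_def)
      have "ennreal c * indicator {1..} t \<le> orlicz_term \<phi> (rearrangement I f t) (w t)"
        if t: "t \<in> I" for t
      proof (cases "1 \<le> t")
        case True
        then have wt: "0 \<le> w t" "w t \<le> w 1"
          using w t by (auto simp: weight_function_def I_Ioi intro: monotone_onD)
        show ?thesis
        proof (cases "w 1 = 0")
          case True
          then have "w t = 0" using wt by simp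
          moreover have "rearrangement I f t \<noteq> 0" using large[of t] s by auto
          ultimately show ?thesis by (simp add: orlicz_term_def)
        next
          case False
          then show ?thesis
            using orlicz_term_ge_perspective[OF \<phi> s large wt] w1 \<open>1 \<le> t\<close> by (simp add: c_def)
        qed
      qed simp
      then have "(\<integral>\<^sup>+ t. ennreal c * indicator {1..} t \<partial>lebesgue_on I) \<le>
          orlicz_integral \<phi> I (rearrangement I f) w"
        unfolding orlicz_integral_def by (intro nn_integral_mono) simp
      moreover have "(\<integral>\<^sup>+ t. ennreal c * indicator {1..} t \<partial>lebesgue_on I) = \<infinity>"
      proof -
        have sets: "{1..} \<in> sets (lebesgue_on I)" using I by (simp add: sets_restrict_space_iff I_Ioi subset_iff)
        have "emeasure (lebesgue_on I) {1..} = emeasure lebesgue {1::real..}"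
          using I by (intro emeasure_restrict_space) (auto simp: I_Ioi)
        also have "\<dots> = \<infinity>" by (rule emeasure_lebesgue_atLeast)
        finally show ?thesis
          using c by (simp add: nn_integral_cmult_indicator[OF sets] ennreal_mult_top)
      qed
      ultimately show False using fin \<open>a = \<infinity>\<close> by (simp add: top_unique)
    qed
  qed
qed

lemma (in vanishing_at_infinity) orlicz_integral_measure_preserving:
  assumes \<phi>: "orlicz_function \<phi>" and w: "weight_function I w"
    and \<rho>: "measure_preserving_between E I \<rho>" and E: "E \<in> sets lebesgue"
  shows "(\<integral>\<^sup>+ t. orlicz_term \<phi> (rearrangement I f (\<rho> t)) (w (\<rho> t)) \<partial>lebesgue_on E) =
    orlicz_integral \<phi> I (rearrangement I f) w"
  unfolding orlicz_integral_def
proof (rule nn_integral_measure_preserving_between[OF \<rho> E I])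
  show "(\<lambda>t. orlicz_term \<phi> (rearrangement I f t) (w t)) \<in> borel_measurable (lebesgue_on I)"
    using w by (intro borel_measurable_orlicz_term[OF \<phi>] borel_measurable_rearrangement[OF I f])
      (auto simp: weight_function_def L0_def)
qed

lemma (in vanishing_at_infinity) ex_equimeasurable_weight:
  assumes \<phi>: "orlicz_function \<phi>" and w: "weight_function I w"
  shows "\<exists>v \<in> {v \<in> L0 I. equimeasurable I v w \<and> (\<forall>t\<in>I. 0 \<le> v t)}.
    orlicz_integral \<phi> I (\<lambda>t. ennreal \<bar>f t\<bar>) v = orlicz_integral \<phi> I (rearrangement I f) w"
proof -
  have wL0: "w \<in> L0 I" and w0: "\<And>t. t \<in> I \<Longrightarrow> 0 \<le> w t" using w by (auto simp: weight_function_def)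
  \<comment> \<open>Outside \<open>ranked\<close> the value 0 exceeds no level
    \<open>s \<ge> 0\<close>, so the distribution function is that of
    \<open>w \<circ> rank_map\<close>.\<close>
  define v where "v t = (if t \<in> ranked then w (rank_map t) else 0)" for t
  note mp = measure_preserving_rank_map
  have ranked: "ranked \<subseteq> I" by (auto simp: ranked_def)
  have ranked_I: "ranked \<inter> space (lebesgue_on I) \<in> sets (lebesgue_on I)"
    by (auto simp: sets_restrict_space_iff)
  have v: "v \<in> L0 I"
  proof -
    have "(\<lambda>t. w (rank_map t)) \<in> borel_measurable (lebesgue_on ranked)"
      using measurable_measure_preserving_between[OF mp ranked_sets I] wL0
      by (auto simp: L0_def intro: measurable_compose)
    then show ?thesis
      unfolding L0_def v_def[abs_def] lebesgue_on_ranked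
      by (subst (asm) measurable_restrict_space_iff[OF ranked_I, of 0]) auto
  qed
  have "distribution_fun I v s = distribution_fun I w s" if "0 \<le> s" for s
  proof -
    have eq: "{t \<in> I. s < \<bar>v t\<bar>} = rank_map -` {t \<in> I. s < \<bar>w t\<bar>} \<inter> ranked"
      using that rank_map_in_I ranked by (auto simp: v_def)
    show ?thesis
      unfolding distribution_fun_def eq
      by (rule measure_preserving_betweenD(2)[OF mp _ L0_sets_greater[OF I wL0]]) blast
  qed
  then have eq: "equimeasurable I v w"
    using equimeasurable_einterval_iff[OF a, of v w] v wL0 by (simp add: I_eq)
  have zero: "orlicz_term \<phi> 0 0 = 0" by (simp add: orlicz_term_def)
  \<comment> \<open>The unranked points are null for finite \<open>a\<close>; for infinite
    \<open>a\<close> both \<open>f\<close> and \<open>v\<close> vanish almost everywhere there, and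
    the convention gives 0.\<close>
  have "AE t in lebesgue_on I. orlicz_term \<phi> (ennreal \<bar>f t\<bar>) (v t) =
      orlicz_term \<phi> (rearrangement I f (rank_map t)) (w (rank_map t)) * indicator ranked t"
  proof (cases "a < \<infinity>")
    case True
    show ?thesis
      using AE_ranked[OF True] AE_rearrangement_rank_map by eventually_elim (simp add: v_def)
  next
    case False
    then have "a = \<infinity>" by simp
    show ?thesis
      using AE_unranked_eq_0[OF \<open>a = \<infinity>\<close>] AE_rearrangement_rank_map
      by eventually_elim (auto simp: v_def zero)
  qed
  then have "orlicz_integral \<phi> I (\<lambda>t. ennreal \<bar>f t\<bar>) v = (\<integral>\<^sup>+ t. orlicz_term \<phi>
      (rearrangement I f (rank_map t)) (w (rank_map t)) * indicator ranked t \<partial>lebesgue_on I)"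
    unfolding orlicz_integral_def by (rule nn_integral_cong_AE)
  also have "\<dots> = (\<integral>\<^sup>+ t. orlicz_term \<phi> (rearrangement I f (rank_map t)) (w (rank_map t)) \<partial>lebesgue_on ranked)"
    unfolding lebesgue_on_ranked by (rule nn_integral_restrict_space[OF ranked_I, symmetric])
  also have "\<dots> = orlicz_integral \<phi> I (rearrangement I f) w"
    by (rule orlicz_integral_measure_preserving[OF \<phi> w mp ranked_sets])
  finally have "orlicz_integral \<phi> I (\<lambda>t. ennreal \<bar>f t\<bar>) v = orlicz_integral \<phi> I (rearrangement I f) w" .
  moreover have "0 \<le> v t" for t using w0 rank_map_in_I by (simp add: v_def)
  ultimately show ?thesis using v eq by blast
qed

theorem theorem2p5:
  fixes \<phi> w :: "real \<Rightarrow> real" and a :: ereal and I :: "real set"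
  assumes "orlicz_function \<phi>"
    and "0 < a"
    and "I = einterval 0 a"
    and "weight_function I w"
  shows "(\<forall>f \<in> L0 I.
            orlicz_integral \<phi> I (rearrangement I f) w =
            (INF v \<in> {v \<in> L0 I. equimeasurable I v w \<and> (\<forall>t\<in>I. 0 \<le> v t)}.
               orlicz_integral \<phi> I (\<lambda>t. ennreal \<bar>f t\<bar>) v))
       \<and> (a < \<infinity> \<longrightarrow> (\<forall>f \<in> L0 I.
            ((\<forall>t\<in>I. 0 < w t) \<or> orlicz_integral \<phi> I (rearrangement I f) w = \<infinity> \<longrightarrow>
               orlicz_integral \<phi> I (rearrangement I f) w =
               (INF v \<in> {v \<in> L0 I. equimeasurable I v w \<and> (\<forall>t\<in>I. 0 < v t)}.
                  orlicz_integral \<phi> I (\<lambda>t. ennreal \<bar>f t\<bar>) v)) \<and>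
            orlicz_integral \<phi> I (rearrangement I f) w =
            (INF \<sigma> \<in> {\<sigma>. measure_preserving_on I \<sigma> \<and> \<sigma> ` I = I}.
               orlicz_integral \<phi> I (\<lambda>t. ennreal \<bar>f t\<bar>) (w \<circ> \<sigma>))))"
proof -
  note \<phi> = assms(1) and a = assms(2) and I_eq = assms(3) and w = assms(4)
  have wL0: "w \<in> L0 I" and w0: "\<And>t. t \<in> I \<Longrightarrow> 0 \<le> w t" using w by (auto simp: weight_function_def)
  have lower: "orlicz_integral \<phi> I (rearrangement I f) w \<le> orlicz_integral \<phi> I (\<lambda>t. ennreal \<bar>f t\<bar>) v"
    if "f \<in> L0 I" "v \<in> L0 I" "equimeasurable I v w" "\<And>t. t \<in> I \<Longrightarrow> 0 \<le> v t" for f v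
    using orlicz_integral_rearrangement_le[OF \<phi> a] w that unfolding I_eq by blast
  have comp: "w \<circ> \<sigma> \<in> L0 I" "equimeasurable I (w \<circ> \<sigma>) w" "\<And>t. t \<in> I \<Longrightarrow> \<sigma> t \<in> I"
    if "measure_preserving_on I \<sigma>" for \<sigma>
    using measure_preserving_comp[OF a] that wL0 unfolding I_eq by (auto simp: measure_preserving_on_def)
  \<comment> \<open>For \<open>y = \<infinity>\<close> the lower bound suffices, even when
    \<open>V\<close> is empty, as happens for positive \<open>v\<close> if \<open>w\<close> has
    zeros.\<close>
  have INF_eqI: "y = (INF v \<in> V. F v)"
    if "\<And>v. v \<in> V \<Longrightarrow> y \<le> F v" "y = \<infinity> \<or> (\<exists>v\<in>V. F v = y)"
    for y :: ennreal and V and F :: "(real \<Rightarrow> real) \<Rightarrow> ennreal"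
  proof (rule antisym)
    show "y \<le> (INF v \<in> V. F v)" using that(1) by (rule INF_greatest)
    show "(INF v \<in> V. F v) \<le> y" using that(2) by (auto intro: INF_lower)
  qed
  have i: "orlicz_integral \<phi> I (rearrangement I f) w =
      (INF v \<in> {v \<in> L0 I. equimeasurable I v w \<and> (\<forall>t\<in>I. 0 \<le> v t)}.
         orlicz_integral \<phi> I (\<lambda>t. ennreal \<bar>f t\<bar>) v)" (is "?L = _") if f: "f \<in> L0 I" for f
  proof (rule INF_eqI)
    show "?L \<le> orlicz_integral \<phi> I (\<lambda>t. ennreal \<bar>f t\<bar>) v"
      if "v \<in> {v \<in> L0 I. equimeasurable I v w \<and> (\<forall>t\<in>I. 0 \<le> v t)}" for v
      using lower[OF f] that by blast
    show "?L = \<infinity> \<or> (\<exists>v \<in> {v \<in> L0 I. equimeasurable I v w \<and> (\<forall>t\<in>I. 0 \<le> v t)}.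
        orlicz_integral \<phi> I (\<lambda>t. ennreal \<bar>f t\<bar>) v = ?L)"
    proof (cases "?L = \<infinity>")
      case False
      then have "?L < \<infinity>" by (simp add: less_top)
      then interpret vanishing_at_infinity a I f
        using vanishing_at_infinityI[OF \<phi> a I_eq w f] by blast
      show ?thesis using ex_equimeasurable_weight[OF \<phi> w] by (rule disjI2)
    qed simp
  qed
  have \<sigma>: "\<exists>\<sigma>. measure_preserving_on I \<sigma> \<and> \<sigma> ` I = I \<and>
      orlicz_integral \<phi> I (\<lambda>t. ennreal \<bar>f t\<bar>) (w \<circ> \<sigma>) = orlicz_integral \<phi> I (rearrangement I f) w"
    if a_fin: "a < \<infinity>" and f: "f \<in> L0 I" for f
  proof -
    interpret vanishing_at_infinity a I f
      using vanishing_at_infinityI[OF \<phi> a I_eq w f] a_fin by blast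
    obtain \<sigma> where \<sigma>: "measure_preserving_on I \<sigma>" "\<sigma> ` I = I"
      and ae: "AE t in lebesgue_on I. ennreal \<bar>f t\<bar> = rearrangement I f (\<sigma> t)"
      using ex_onto_measure_preserving[OF a_fin] by blast
    have "orlicz_integral \<phi> I (\<lambda>t. ennreal \<bar>f t\<bar>) (w \<circ> \<sigma>) =
        (\<integral>\<^sup>+ t. orlicz_term \<phi> (rearrangement I f (\<sigma> t)) (w (\<sigma> t)) \<partial>lebesgue_on I)"
      unfolding orlicz_integral_def
      by (rule nn_integral_cong_AE) (use ae in eventually_elim, simp)
    also have "\<dots> = orlicz_integral \<phi> I (rearrangement I f) w"
      using \<sigma>(1) I by (intro orlicz_integral_measure_preserving[OF \<phi> w])
        (simp_all add: measure_preserving_on_iff_between)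
    finally show ?thesis using \<sigma> by blast
  qed
  have ii_pos: "orlicz_integral \<phi> I (rearrangement I f) w =
      (INF v \<in> {v \<in> L0 I. equimeasurable I v w \<and> (\<forall>t\<in>I. 0 < v t)}.
         orlicz_integral \<phi> I (\<lambda>t. ennreal \<bar>f t\<bar>) v)" (is "?L = _")
    if a_fin: "a < \<infinity>" and f: "f \<in> L0 I" and pos: "(\<forall>t\<in>I. 0 < w t) \<or> orlicz_integral \<phi> I (rearrangement I f) w = \<infinity>" for f
  proof (rule INF_eqI)
    show "?L \<le> orlicz_integral \<phi> I (\<lambda>t. ennreal \<bar>f t\<bar>) v"
      if "v \<in> {v \<in> L0 I. equimeasurable I v w \<and> (\<forall>t\<in>I. 0 < v t)}" for v
      using lower[OF f] that less_imp_le by blast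
    show "?L = \<infinity> \<or> (\<exists>v \<in> {v \<in> L0 I. equimeasurable I v w \<and> (\<forall>t\<in>I. 0 < v t)}.
        orlicz_integral \<phi> I (\<lambda>t. ennreal \<bar>f t\<bar>) v = ?L)"
    proof (cases "?L = \<infinity>")
      case False
      obtain \<sigma> where "measure_preserving_on I \<sigma>"
        "orlicz_integral \<phi> I (\<lambda>t. ennreal \<bar>f t\<bar>) (w \<circ> \<sigma>) = ?L"
        using \<sigma>[OF a_fin f] by blast
      \<comment> \<open>A finite integral leaves the case \<open>w > 0\<close>, so that
        \<open>w \<circ> \<sigma>\<close> is positive.\<close>
      with comp[of \<sigma>] pos False show ?thesis by (intro disjI2 bexI[of _ "w \<circ> \<sigma>"]) auto
    qed simp
  qed
  have ii_\<sigma>: "orlicz_integral \<phi> I (rearrangement I f) w =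
      (INF \<sigma> \<in> {\<sigma>. measure_preserving_on I \<sigma> \<and> \<sigma> ` I = I}.
         orlicz_integral \<phi> I (\<lambda>t. ennreal \<bar>f t\<bar>) (w \<circ> \<sigma>))" (is "?L = _")
    if a_fin: "a < \<infinity>" and f: "f \<in> L0 I" for f
  proof (rule INF_eqI)
    show "?L \<le> orlicz_integral \<phi> I (\<lambda>t. ennreal \<bar>f t\<bar>) (w \<circ> \<sigma>)"
      if "\<sigma> \<in> {\<sigma>. measure_preserving_on I \<sigma> \<and> \<sigma> ` I = I}" for \<sigma>
      using comp[of \<sigma>] w0 that by (intro lower[OF f]) auto
    show "?L = \<infinity> \<or> (\<exists>\<sigma> \<in> {\<sigma>. measure_preserving_on I \<sigma> \<and> \<sigma> ` I = I}.
        orlicz_integral \<phi> I (\<lambda>t. ennreal \<bar>f t\<bar>) (w \<circ> \<sigma>) = ?L)"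
      using \<sigma>[OF a_fin f] by blast
  qed
  show ?thesis using i ii_pos ii_\<sigma> by blast
qed

end
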